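(* Let $R$ be an FGFC-ring. Then any (commutative) $R$-algebra $S$ which is finitely presented as an $R$-module is an FGFC-ring.
   Context: All rings (and algebras) are commutative with identity. For a ring $A$ and an $A$-module $M$, let $\operatorname{Supp}_A M$ denote the support of $M$ and let $\operatorname{Min}_A M$ denote the set of minimal elements (with respect to inclusion) of $\operatorname{Supp}_A M$. An $A$-module $M$ is said to be FGFC if for every finitely generated $A$-submodule $N$ of $M$, $\operatorname{Supp}_A (M/N)$ is a finite union of irreducible closed subsets of $\operatorname{Spec} A$; equivalently, $\operatorname{Min}_A (M/N)$ is a finite set. A ring $A$ is an FGFC-ring if it is FGFC as an $A$-module; that is, for every finitely generated ideal $I$ of $A$, the set of primes of $A$ minimal over $I$ is finite. *)

theory Defs
  imports "HOL-Algebra.Module" "HOL-Algebra.QuotRing"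
begin

text \<open>The type \<^typ>\<open>('a, 'b) module\<close> extends \<^typ>\<open>'b ring\<close>, but the locale \<^locale>\<open>module\<close>
  does not constrain \<^const>\<open>mult\<close> and \<^const>\<open>one\<close> of the module. These two fields
  are therefore left undefined in the modules constructed below.\<close>


section \<open>Modules\<close>

definition ring_as_module :: "('a, 'm) ring_scheme \<Rightarrow> ('a, 'a) module" where
  "ring_as_module R =
    \<lparr>carrier = carrier R, mult = undefined, one = undefined,
     zero = \<zero>\<^bsub>R\<^esub>, add = add R, smult = mult R\<rparr>"

definition free_module :: "('a, 'm) ring_scheme \<Rightarrow> nat \<Rightarrow> ('a, nat \<Rightarrow> 'a) module" where
  "free_module R n =
    \<lparr>carrier = {..<n} \<rightarrow>\<^sub>E carrier R, mult = undefined, one = undefined,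
     zero = (\<lambda>i\<in>{..<n}. \<zero>\<^bsub>R\<^esub>),
     add = (\<lambda>v w. \<lambda>i\<in>{..<n}. v i \<oplus>\<^bsub>R\<^esub> w i),
     smult = (\<lambda>r v. \<lambda>i\<in>{..<n}. r \<otimes>\<^bsub>R\<^esub> v i)\<rparr>"

definition quotient_module ::
    "('a, 'b, 'm) module_scheme \<Rightarrow> 'b set \<Rightarrow> ('a, 'b set) module" where
  "quotient_module M N =
    \<lparr>carrier = a_rcosets\<^bsub>M\<^esub> N, mult = undefined, one = undefined,
     zero = N, add = set_add M,
     smult = (\<lambda>r X. \<Union>x\<in>X. N +>\<^bsub>M\<^esub> (r \<odot>\<^bsub>M\<^esub> x))\<rparr>"

definition linear_maps ::
    "('a, 'm) ring_scheme \<Rightarrow> ('a, 'b, 'n) module_scheme \<Rightarrow> ('a, 'c, 'k) module_scheme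
      \<Rightarrow> ('b \<Rightarrow> 'c) set" where
  "linear_maps R M N =
    {h \<in> carrier M \<rightarrow> carrier N.
      (\<forall>x\<in>carrier M. \<forall>y\<in>carrier M. h (x \<oplus>\<^bsub>M\<^esub> y) = h x \<oplus>\<^bsub>N\<^esub> h y) \<and>
      (\<forall>r\<in>carrier R. \<forall>x\<in>carrier M. h (r \<odot>\<^bsub>M\<^esub> x) = r \<odot>\<^bsub>N\<^esub> h x)}"

definition submodule_span ::
    "('a, 'm) ring_scheme \<Rightarrow> ('a, 'b, 'n) module_scheme \<Rightarrow> 'b set \<Rightarrow> 'b set" where
  "submodule_span R M X = \<Inter>{N. submodule N R M \<and> X \<subseteq> N}"

definition fg_submodule ::
    "('a, 'm) ring_scheme \<Rightarrow> ('a, 'b, 'n) module_scheme \<Rightarrow> 'b set \<Rightarrow> bool" where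
  "fg_submodule R M N \<longleftrightarrow> (\<exists>X. finite X \<and> X \<subseteq> carrier M \<and> N = submodule_span R M X)"

definition finitely_presented ::
    "('a, 'm) ring_scheme \<Rightarrow> ('a, 'b, 'n) module_scheme \<Rightarrow> bool" where
  "finitely_presented R M \<longleftrightarrow>
    (\<exists>n. \<exists>h\<in>linear_maps R (free_module R n) M.
      h ` carrier (free_module R n) = carrier M \<and>
      fg_submodule R (free_module R n) (a_kernel (free_module R n) M h))"


section \<open>Spectrum and support\<close>

definition Spec :: "('a, 'm) ring_scheme \<Rightarrow> 'a set set" where
  "Spec R = {P. primeideal P R}"

definition zariski_closed :: "('a, 'm) ring_scheme \<Rightarrow> 'a set set \<Rightarrow> bool" where
  "zariski_closed R Z \<longleftrightarrow> (\<exists>I. ideal I R \<and> Z = {P \<in> Spec R. I \<subseteq> P})"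

text \<open>Since \<open>Z\<close> is closed, its relatively closed subsets are the closed subsets of the spectrum
  contained in it.\<close>

definition irreducible_closed :: "('a, 'm) ring_scheme \<Rightarrow> 'a set set \<Rightarrow> bool" where
  "irreducible_closed R Z \<longleftrightarrow>
    zariski_closed R Z \<and> Z \<noteq> {} \<and>
    (\<forall>A B. zariski_closed R A \<longrightarrow> zariski_closed R B \<longrightarrow> Z = A \<union> B \<longrightarrow> Z = A \<or> Z = B)"

text \<open>Fractions \<open>m/s\<close> are pairs \<open>(m, s)\<close>, and \<open>localization R M P\<close> is the underlying set of
  the localization of \<open>M\<close> at the prime \<open>P\<close>.\<close>

definition localization_rel ::
    "('a, 'm) ring_scheme \<Rightarrow> ('a, 'b, 'n) module_scheme \<Rightarrow> 'a set
      \<Rightarrow> (('b \<times> 'a) \<times> ('b \<times> 'a)) set" where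
  "localization_rel R M P =
    {((m, s), (n, t)). m \<in> carrier M \<and> s \<in> carrier R - P \<and> n \<in> carrier M \<and> t \<in> carrier R - P \<and>
      (\<exists>u\<in>carrier R - P. u \<odot>\<^bsub>M\<^esub> ((t \<odot>\<^bsub>M\<^esub> m) \<ominus>\<^bsub>M\<^esub> (s \<odot>\<^bsub>M\<^esub> n)) = \<zero>\<^bsub>M\<^esub>)}"

definition localization ::
    "('a, 'm) ring_scheme \<Rightarrow> ('a, 'b, 'n) module_scheme \<Rightarrow> 'a set \<Rightarrow> ('b \<times> 'a) set set" where
  "localization R M P = (carrier M \<times> (carrier R - P)) // localization_rel R M P"

definition Supp ::
    "('a, 'm) ring_scheme \<Rightarrow> ('a, 'b, 'n) module_scheme \<Rightarrow> 'a set set" where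
  "Supp R M =
    {P \<in> Spec R. localization R M P \<noteq> {localization_rel R M P `` {(\<zero>\<^bsub>M\<^esub>, \<one>\<^bsub>R\<^esub>)}}}"


section \<open>FGFC modules and rings\<close>

definition fgfc_module ::
    "('a, 'm) ring_scheme \<Rightarrow> ('a, 'b, 'n) module_scheme \<Rightarrow> bool" where
  "fgfc_module R M \<longleftrightarrow>
    (\<forall>N. fg_submodule R M N \<longrightarrow>
      (\<exists>\<F>. finite \<F> \<and> (\<forall>Z\<in>\<F>. irreducible_closed R Z) \<and>
        Supp R (quotient_module M N) = \<Union>\<F>))"

definition fgfc_ring :: "('a, 'm) ring_scheme \<Rightarrow> bool" where
  "fgfc_ring R \<longleftrightarrow> cring R \<and> fgfc_module R (ring_as_module R)"

end

theory Submission
  imports Defs "HOL-Algebra.Ring_Divisibility"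
begin

text \<open>A finitely generated ideal \<open>I\<close> of \<open>S\<close> presents \<open>S / I\<close> as the cokernel of a matrix over \<open>R\<close>.
  Gaussian elimination, branching on which pivots lie in a prime, yields finitely many finite
  subsets \<open>X\<close> of \<open>R\<close> such that every prime \<open>P\<close> contains one of them for which, whenever
  \<open>X \<subseteq> P' \<subseteq> P\<close>, the localization at \<open>P\<close> of \<open>S / (I + P'S)\<close> is torsion-free over \<open>R\<^sub>P / P'\<close>.
  Going down then holds from \<open>P\<close> to \<open>P'\<close>, so that a prime minimal over \<open>I\<close> lies over a prime
  minimal over one of the sets \<open>X\<close>, and there are only finitely many of these because \<open>R\<close> is FGFC.
  Finally, at most \<open>n\<close> pairwise incomparable primes of \<open>S\<close> lie over a given prime if \<open>S\<close> is
  generated by \<open>n\<close> elements as an \<open>R\<close>-module.\<close>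

section \<open>Prime ideals\<close>

text \<open>A prime minimal over \<open>I\<close> need not contract to a prime minimal over the
  contraction of \<open>I\<close>: for \<open>R = k[x]\<close>, \<open>S = k[x] \<times> k\<close>
  and \<open>I = 0\<close>, one of the two contractions is \<open>(x)\<close>. Moreover, the
  contraction of \<open>I\<close> need not be finitely generated, so the hypothesis on
  \<open>R\<close> does not apply to it. The finite sets \<open>X\<close> take its place.
  Torsion-freeness yields going down as follows. Let \<open>Q\<close> be minimal over
  \<open>I\<close> with contraction \<open>P\<close>, and let
  \<open>X \<subseteq> P' \<subseteq> P\<close>. No product of the image of an element outside
  \<open>P'\<close> with an element outside \<open>Q\<close> lies in \<open>I + P'S\<close>. A prime
  containing \<open>I + P'S\<close> and avoiding all these products lies inside \<open>Q\<close> and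
  over \<open>P'\<close>; it equals \<open>Q\<close> by minimality, so \<open>P' = P\<close>.
  Torsion-freeness itself holds because, once the pivots (which lie outside \<open>P\<close>) are
  inverted and the remaining entries vanish modulo \<open>P'\<close>, the cokernel is free over
  \<open>R\<^sub>P / P'\<close>. Finite presentation of \<open>S\<close> and finite generation of
  \<open>I\<close> make the matrix finite, hence also the number of ways to choose pivots.\<close>

definition minimal_primes :: "('a, 'm) ring_scheme \<Rightarrow> 'a set \<Rightarrow> 'a set set" where
  "minimal_primes R X =
    {P. primeideal P R \<and> X \<subseteq> P \<and> (\<forall>P'. primeideal P' R \<longrightarrow> X \<subseteq> P' \<longrightarrow> P' \<subseteq> P \<longrightarrow> P' = P)}"

lemma primeideal_carrier: "primeideal P R \<Longrightarrow> P \<subseteq> carrier R"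
  by (simp add: primeideal_def ideal_def additive_subgroup.a_subset)

lemma primeideal_one: "primeideal P R \<Longrightarrow> \<one>\<^bsub>R\<^esub> \<notin> P"
  by (metis ideal.one_imp_carrier primeideal.I_notcarr primeideal.axioms(1))

text \<open>An ideal maximal among those that contain \<open>I\<close> and miss \<open>W\<close> is
  prime: if \<open>a\<close> and \<open>b\<close> lie outside it, adjoining either one produces an
  element of \<open>W\<close>, and the product of these two elements is in \<open>W\<close> and,
  should \<open>a \<otimes> b\<close> be in the ideal, also in the ideal.\<close>

lemma (in cring) exists_prime_disjoint:
  assumes I: "ideal I R" and W: "W \<subseteq> carrier R" "\<one> \<in> W"
    and Wm: "\<And>x y. x \<in> W \<Longrightarrow> y \<in> W \<Longrightarrow> x \<otimes> y \<in> W" and dis: "I \<inter> W = {}"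
  obtains P where "primeideal P R" "I \<subseteq> P" "P \<inter> W = {}"
proof -
  let ?A = "{J. ideal J R \<and> I \<subseteq> J \<and> J \<inter> W = {}}"
  have "\<exists>M\<in>?A. \<forall>X\<in>?A. M \<subseteq> X \<longrightarrow> X = M"
  proof (rule subset_Zorn_nonempty)
    show "?A \<noteq> {}" using I dis by blast
  next
    fix C assume C: "C \<noteq> {}" "subset.chain ?A C"
    have CA: "C \<subseteq> ?A" using C by (simp add: pred_on.chain_def)
    have "subset.chain {I. ideal I R} C" using C by (auto simp: pred_on.chain_def)
    from chain_Union_is_ideal[OF this] have "ideal (\<Union>C) R" using C(1) by simp
    moreover have "I \<subseteq> \<Union>C" using CA C(1) by blast
    moreover have "\<Union>C \<inter> W = {}" using CA by blast
    ultimately show "\<Union>C \<in> ?A" by simp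
  qed
  then obtain M where MA: "M \<in> ?A" and mx: "\<forall>X\<in>?A. M \<subseteq> X \<longrightarrow> X = M"
    by (rule bexE)
  have M: "ideal M R" "I \<subseteq> M" "M \<inter> W = {}" using MA by auto
  have max: "J = M" if "ideal J R" "M \<subseteq> J" "J \<inter> W = {}" for J
    using mx that M(2) by (simp add: subset_trans[OF M(2)])
  interpret M: ideal M R by fact
  have ext: "\<exists>m\<in>M. \<exists>r\<in>carrier R. m \<oplus> r \<otimes> a \<in> W" if a: "a \<in> carrier R" "a \<notin> M" for a
  proof -
    let ?J = "M <+>\<^bsub>R\<^esub> PIdl a"
    have J: "ideal ?J R" by (intro add_ideals M(1) cgenideal_ideal a)
    interpret P: ideal "PIdl a" R by (intro cgenideal_ideal a)
    have elem: "x \<oplus> y \<in> ?J" if "x \<in> M" "y \<in> PIdl a" for x y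
      using that by (auto simp: set_add_def')
    have sub: "M \<subseteq> ?J" using elem[OF _ P.zero_closed] M.Icarr by fastforce
    have "a \<in> ?J" using elem[OF M.zero_closed cgenideal_self[OF a(1)]] a(1) by simp
    with a(2) have "?J \<noteq> M" by blast
    with max[OF J sub] obtain w where "w \<in> ?J" "w \<in> W" by blast
    then obtain m y where "m \<in> M" "y \<in> PIdl a" "m \<oplus> y \<in> W" by (auto simp: set_add_def')
    thus ?thesis unfolding cgenideal_def by blast
  qed
  have "primeideal M R"
  proof (rule primeidealI[OF M(1) is_cring])
    show "carrier R \<noteq> M" using M(3) W by blast
  next
    fix a b assume ab: "a \<in> carrier R" "b \<in> carrier R" "a \<otimes> b \<in> M"
    show "a \<in> M \<or> b \<in> M"
    proof (rule ccontr)
      assume "\<not> ?thesis"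
      then obtain m r m' r' where
        m: "m \<in> M" "r \<in> carrier R" "m \<oplus> r \<otimes> a \<in> W" "m' \<in> M" "r' \<in> carrier R" "m' \<oplus> r' \<otimes> b \<in> W"
        using ext[OF ab(1)] ext[OF ab(2)] by blast
      have c: "m \<in> carrier R" "m' \<in> carrier R" using m M.Icarr by auto
      have "(m \<oplus> r \<otimes> a) \<otimes> (m' \<oplus> r' \<otimes> b) =
          m \<otimes> (m' \<oplus> r' \<otimes> b) \<oplus> ((r \<otimes> a) \<otimes> m' \<oplus> (r \<otimes> r') \<otimes> (a \<otimes> b))"
        using c m ab by algebra
      moreover have "\<dots> \<in> M"
        using c m ab M.I_r_closed[OF m(1)] M.I_l_closed[OF m(4)] M.I_l_closed[OF ab(3)]
        by (intro M.a_closed) auto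
      ultimately show False using Wm[OF m(3,6)] M(3) by auto
    qed
  qed
  thus ?thesis using that M by blast
qed

text \<open>Zorn's lemma is applied to multiplicative sets growing from the complement of
  \<open>Q\<close> instead of primes shrinking inside \<open>Q\<close>: upper bounds are plain
  unions, and a prime avoiding a maximal such set is minimal over \<open>X\<close>.\<close>

lemma (in cring) exists_minimal_prime:
  assumes Q: "primeideal Q R" "X \<subseteq> Q"
  obtains P where "P \<in> minimal_primes R X" "P \<subseteq> Q"
proof -
  interpret Q: primeideal Q R by fact
  have X: "X \<subseteq> carrier R" using Q Q.Icarr by blast
  let ?W = "{W. carrier R - Q \<subseteq> W \<and> W \<subseteq> carrier R \<and> (\<forall>x\<in>W. \<forall>y\<in>W. x \<otimes> y \<in> W) \<and> Idl X \<inter> W = {}}"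
  have "\<exists>M\<in>?W. \<forall>X\<in>?W. M \<subseteq> X \<longrightarrow> X = M"
  proof (rule subset_Zorn_nonempty)
    have "Idl X \<subseteq> Q" using Q by (intro genideal_minimal) (auto intro: Q.is_ideal)
    hence "carrier R - Q \<in> ?W" using Q.I_prime by auto
    thus "?W \<noteq> {}" by blast
  next
    fix C assume C: "C \<noteq> {}" "subset.chain ?W C"
    have CW: "C \<subseteq> ?W" using C by (simp add: pred_on.chain_def)
    have "x \<otimes> y \<in> \<Union>C" if xy: "x \<in> \<Union>C" "y \<in> \<Union>C" for x y
    proof -
      obtain U V where UV: "U \<in> C" "V \<in> C" "x \<in> U" "y \<in> V" using xy by blast
      have "U \<subseteq> V \<or> V \<subseteq> U" using C(2) UV by (meson subset_chain_def)
      thus ?thesis using UV CW by blast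
    qed
    moreover have "carrier R - Q \<subseteq> \<Union>C" "\<Union>C \<subseteq> carrier R" "Idl X \<inter> \<Union>C = {}"
      using C(1) CW by blast+
    ultimately show "\<Union>C \<in> ?W" by blast
  qed
  then obtain W where WA: "W \<in> ?W" and mx: "\<forall>V\<in>?W. W \<subseteq> V \<longrightarrow> V = W"
    by (rule bexE)
  have W: "carrier R - Q \<subseteq> W" "W \<subseteq> carrier R" "\<And>x y. x \<in> W \<Longrightarrow> y \<in> W \<Longrightarrow> x \<otimes> y \<in> W"
      "Idl X \<inter> W = {}"
    using WA by blast+
  have "\<one> \<in> W" using W(1) primeideal_one[OF Q(1)] by blast
  then obtain P where P: "primeideal P R" "Idl X \<subseteq> P" "P \<inter> W = {}"
    using exists_prime_disjoint[OF genideal_ideal[OF X] W(2) _ W(3,4)] by blast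
  \<comment> \<open>The complement of \<open>P'\<close> is a competitor containing \<open>W\<close>,
    hence equals \<open>W\<close>; as \<open>P\<close> avoids \<open>W\<close>, this puts
    \<open>P\<close> inside \<open>P'\<close>.\<close>
  have "P' = P" if P': "primeideal P' R" "X \<subseteq> P'" "P' \<subseteq> P" for P'
  proof -
    interpret P': primeideal P' R by fact
    have "Idl X \<subseteq> P'" by (intro genideal_minimal P') (rule P'.is_ideal)
    hence "carrier R - P' \<in> ?W" using P'.I_prime P'(3) P(3) W(1) by blast
    moreover have "W \<subseteq> carrier R - P'" using P'(3) P(3) W(2) by blast
    ultimately have "carrier R - P' = W" using mx by blast
    thus ?thesis using P(3) P'(3) primeideal_carrier[OF P(1)] by blast
  qed
  hence "P \<in> minimal_primes R X"
    using P genideal_self[OF X] unfolding minimal_primes_def by blast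
  moreover have "P \<subseteq> Q" using P W(1) primeideal_carrier[OF P(1)] by blast
  ultimately show ?thesis by (rule that)
qed

text \<open>Multiply together one element outside \<open>Q\<close> from each ideal. For pairwise
  incomparable primes this supplies the separating elements of the fibre bound.\<close>

lemma (in cring) prime_avoids_intersection:
  assumes "finite \<Q>" and "\<And>J. J \<in> \<Q> \<Longrightarrow> ideal J R" and Q: "primeideal Q R"
    and "\<And>J. J \<in> \<Q> \<Longrightarrow> \<not> J \<subseteq> Q"
  shows "\<exists>e\<in>carrier R. e \<notin> Q \<and> (\<forall>J\<in>\<Q>. e \<in> J)"
  using assms(1,2,4)
proof (induction \<Q>)
  case empty
  show ?case using primeideal_one[OF Q] by auto
next
  case (insert J \<Q>)
  interpret Q: primeideal Q R by fact
  interpret J: ideal J R using insert by simp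
  obtain e where e: "e \<in> carrier R" "e \<notin> Q" "\<forall>J\<in>\<Q>. e \<in> J" using insert by auto
  obtain f where f: "f \<in> J" "f \<notin> Q" using insert.prems(2)[of J] by blast
  have "e \<otimes> f \<notin> Q" using Q.I_prime e f J.Icarr by blast
  moreover have "e \<otimes> f \<in> K" if "K \<in> insert J \<Q>" for K
    using that e f J.Icarr insert.prems(1) J.I_l_closed ideal.I_r_closed[of K R e f] by auto
  ultimately show ?case using e f J.Icarr by (intro bexI[of _ "e \<otimes> f"]) auto
qed

section \<open>Support of cyclic modules\<close>

lemma ring_as_module_simps:
  "subgroup N (add_monoid (ring_as_module R)) \<longleftrightarrow> subgroup N (add_monoid R)"
  "a_r_coset (ring_as_module R) = a_r_coset R"
  "A_RCOSETS (ring_as_module R) = A_RCOSETS R"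
  "set_add (ring_as_module R) = set_add R"
  "smult (ring_as_module R) = monoid.mult R"
  by (auto simp: ring_as_module_def subgroup_def m_inv_def a_r_coset_def' A_RCOSETS_def'
      set_add_def' fun_eq_iff)

lemma (in cring) submodule_ring_as_module_iff: "submodule N R (ring_as_module R) \<longleftrightarrow> ideal N R"
proof
  assume "submodule N R (ring_as_module R)"
  hence N: "subgroup N (add_monoid R)" "\<And>a x. a \<in> carrier R \<Longrightarrow> x \<in> N \<Longrightarrow> a \<otimes> x \<in> N"
    by (auto simp: submodule_def submodule_axioms_def ring_as_module_simps)
  show "ideal N R"
  proof (rule idealI[OF ring_axioms N(1)])
    fix a x assume ax: "a \<in> N" "x \<in> carrier R"
    thus "x \<otimes> a \<in> N" by (rule N(2)[rotated])
    moreover have "a \<in> carrier R" using subgroup.mem_carrier[OF N(1) ax(1)] by simp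
    ultimately show "a \<otimes> x \<in> N" using ax by (simp add: m_comm)
  qed
next
  assume "ideal N R"
  then interpret N: ideal N R .
  show "submodule N R (ring_as_module R)"
    using N.a_subgroup N.I_l_closed
    by (auto simp: submodule_def submodule_axioms_def ring_as_module_simps)
qed

lemma (in cring) fg_submodule_ring_as_module_iff:
  "fg_submodule R (ring_as_module R) N \<longleftrightarrow> (\<exists>X. finite X \<and> X \<subseteq> carrier R \<and> N = Idl X)"
  unfolding fg_submodule_def submodule_span_def submodule_ring_as_module_iff genideal_def
  by (simp add: ring_as_module_def)

lemma (in ideal) quotient_module_simps:
  assumes "cring R"
  shows "carrier (quotient_module (ring_as_module R) I) = carrier (R Quot I)"
    and "\<zero>\<^bsub>quotient_module (ring_as_module R) I\<^esub> = I"
    and "x \<in> carrier R \<Longrightarrow> y \<in> carrier R \<Longrightarrow>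
      (I +> x) \<ominus>\<^bsub>quotient_module (ring_as_module R) I\<^esub> (I +> y) = I +> (x \<ominus> y)"
    and "r \<in> carrier R \<Longrightarrow> x \<in> carrier R \<Longrightarrow>
      r \<odot>\<^bsub>quotient_module (ring_as_module R) I\<^esub> (I +> x) = I +> (r \<otimes> x)"
proof -
  let ?Q = "quotient_module (ring_as_module R) I"
  interpret cring R by fact
  \<comment> \<open>Negation depends only on carrier, zero and addition, in which the two structures
    coincide.\<close>
  have neg: "a_inv ?Q = a_inv (R Quot I)"
    by (simp add: quotient_module_def FactRing_def a_inv_def m_inv_def ring_as_module_simps
        fun_eq_iff)
  show carr: "carrier ?Q = carrier (R Quot I)" and "\<zero>\<^bsub>?Q\<^esub> = I"
    by (simp_all add: quotient_module_def FactRing_def ring_as_module_simps)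
  have ad: "add ?Q = add (R Quot I)"
    by (simp add: quotient_module_def FactRing_def ring_as_module_simps)
  show "(I +> x) \<ominus>\<^bsub>?Q\<^esub> (I +> y) = I +> (x \<ominus> y)" if "x \<in> carrier R" "y \<in> carrier R"
  proof -
    have "(I +> x) \<ominus>\<^bsub>?Q\<^esub> (I +> y) = (I +> x) \<ominus>\<^bsub>R Quot I\<^esub> (I +> y)"
      by (simp add: a_minus_def neg ad)
    also have "\<dots> = (I +> x) <+>\<^bsub>R\<^esub> (I +> \<ominus> y)"
      using ring_hom_cring.hom_a_inv[OF rcos_ring_hom_cring[OF \<open>cring R\<close>] that(2)]
      by (simp add: a_minus_def) (simp add: FactRing_def)
    also have "\<dots> = I +> (x \<ominus> y)" using that by (simp add: a_minus_def a_rcos_sum)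
    finally show ?thesis .
  qed
  show "r \<odot>\<^bsub>?Q\<^esub> (I +> x) = I +> (r \<otimes> x)" if r: "r \<in> carrier R" and x: "x \<in> carrier R"
  proof -
    \<comment> \<open>The scalar multiple is a union over all representatives \<open>x'\<close>;
      every member of the union is the same coset.\<close>
    have "I +> (r \<otimes> x') = I +> (r \<otimes> x)" if "x' \<in> I +> x" for x'
    proof -
      from that obtain i where i: "i \<in> I" "x' = i \<oplus> x" by (auto simp: a_r_coset_def')
      have "r \<otimes> x' \<ominus> r \<otimes> x = r \<otimes> i" using i(1) a_Hcarr r x unfolding i(2) by algebra
      also have "\<dots> \<in> I" using I_l_closed i(1) r by simp
      finally show ?thesis
        using quotient_eq_iff_same_a_r_cos[OF is_ideal, of "r \<otimes> x'" "r \<otimes> x"] i r x a_Hcarr by simp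
    qed
    moreover have "x \<in> I +> x" using x by (rule a_rcos_self)
    moreover have "r \<odot>\<^bsub>?Q\<^esub> (I +> x) = (\<Union>x'\<in>I +> x. I +> (r \<otimes> x'))"
      by (simp add: quotient_module_def ring_as_module_simps)
    ultimately show ?thesis by blast
  qed
qed

text \<open>The localization of \<open>R / I\<close> at \<open>P\<close> vanishes exactly when some
  element outside \<open>P\<close> kills the class of \<open>\<one>\<close>, that is, lies in
  \<open>I\<close>.\<close>

lemma (in cring) Supp_cyclic:
  assumes "ideal I R"
  shows "Supp R (quotient_module (ring_as_module R) I) = {P \<in> Spec R. I \<subseteq> P}"
proof -
  interpret I: ideal I R by fact
  let ?Q = "quotient_module (ring_as_module R) I"
  note Q = I.quotient_module_simps[OF is_cring]
  have carr: "carrier ?Q = (\<lambda>x. I +> x) ` carrier R"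
    by (auto simp: Q(1) FactRing_def A_RCOSETS_def' )
  have coset_eq_iff: "I +> x = I \<longleftrightarrow> x \<in> I" if "x \<in> carrier R" for x
    using I.a_rcos_const I.rcos_const_imp_mem[OF that] by blast
  have rel: "((I +> m, s), (I +> n, t)) \<in> localization_rel R ?Q P \<longleftrightarrow>
      s \<notin> P \<and> t \<notin> P \<and> (\<exists>u\<in>carrier R - P. u \<otimes> (t \<otimes> m \<ominus> s \<otimes> n) \<in> I)"
    if "m \<in> carrier R" "n \<in> carrier R" "s \<in> carrier R" "t \<in> carrier R" for m n s t P
  proof -
    have mem: "I +> m \<in> carrier ?Q" "I +> n \<in> carrier ?Q" using that carr by blast+
    have "u \<odot>\<^bsub>?Q\<^esub> ((t \<odot>\<^bsub>?Q\<^esub> (I +> m)) \<ominus>\<^bsub>?Q\<^esub> (s \<odot>\<^bsub>?Q\<^esub> (I +> n))) = \<zero>\<^bsub>?Q\<^esub> \<longleftrightarrow>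
        u \<otimes> (t \<otimes> m \<ominus> s \<otimes> n) \<in> I" if u: "u \<in> carrier R" for u
    proof -
      note c = u \<open>m \<in> carrier R\<close> \<open>n \<in> carrier R\<close> \<open>s \<in> carrier R\<close> \<open>t \<in> carrier R\<close>
      have "u \<odot>\<^bsub>?Q\<^esub> ((t \<odot>\<^bsub>?Q\<^esub> (I +> m)) \<ominus>\<^bsub>?Q\<^esub> (s \<odot>\<^bsub>?Q\<^esub> (I +> n))) = I +> u \<otimes> (t \<otimes> m \<ominus> s \<otimes> n)"
        using c by (simp only: Q(3,4) m_closed minus_closed)
      thus ?thesis using coset_eq_iff[of "u \<otimes> (t \<otimes> m \<ominus> s \<otimes> n)"] c by (simp add: Q(2))
    qed
    hence "(\<exists>u\<in>carrier R - P. u \<odot>\<^bsub>?Q\<^esub> ((t \<odot>\<^bsub>?Q\<^esub> (I +> m)) \<ominus>\<^bsub>?Q\<^esub> (s \<odot>\<^bsub>?Q\<^esub> (I +> n))) = \<zero>\<^bsub>?Q\<^esub>) \<longleftrightarrow>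
        (\<exists>u\<in>carrier R - P. u \<otimes> (t \<otimes> m \<ominus> s \<otimes> n) \<in> I)"
      by blast
    thus ?thesis using that mem unfolding localization_rel_def by simp
  qed
  have "localization R ?Q P \<noteq> {localization_rel R ?Q P `` {(\<zero>\<^bsub>?Q\<^esub>, \<one>)}} \<longleftrightarrow> I \<subseteq> P"
    if P: "primeideal P R" for P
  proof -
    interpret P: primeideal P R by fact
    have one: "\<one> \<notin> P" using P by (rule primeideal_one)
    have zero: "\<zero>\<^bsub>?Q\<^esub> = I +> \<zero>" by (simp add: Q(2) I.a_rcos_const)
    let ?r = "localization_rel R ?Q P"
    have zero_mem: "(\<zero>\<^bsub>?Q\<^esub>, \<one>) \<in> carrier ?Q \<times> (carrier R - P)" using one carr zero by auto
    show ?thesis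
    proof
      assume ne: "localization R ?Q P \<noteq> {?r `` {(\<zero>\<^bsub>?Q\<^esub>, \<one>)}}"
      show "I \<subseteq> P"
      proof (rule ccontr)
        assume "\<not> I \<subseteq> P"
        then obtain u where u: "u \<in> I" "u \<notin> P" by blast
        \<comment> \<open>The element \<open>u\<close> annihilates all of \<open>R / I\<close>, so
          any two fractions are identified.\<close>
        have "(x, y) \<in> ?r"
          if xy: "x \<in> carrier ?Q \<times> (carrier R - P)" "y \<in> carrier ?Q \<times> (carrier R - P)"
          for x y
        proof -
          obtain m s n t where "x = (I +> m, s)" "y = (I +> n, t)" "m \<in> carrier R" "n \<in> carrier R"
            "s \<in> carrier R - P" "t \<in> carrier R - P" using xy carr by auto
          thus ?thesis using u I.I_r_closed[OF u(1)] I.Icarr by (auto simp: rel intro!: bexI[of _ u])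
        qed
        moreover have "?r \<subseteq> (carrier ?Q \<times> (carrier R - P)) \<times> (carrier ?Q \<times> (carrier R - P))"
          by (auto simp: localization_rel_def)
        ultimately have "?r = (carrier ?Q \<times> (carrier R - P)) \<times> (carrier ?Q \<times> (carrier R - P))"
          by auto
        hence "localization R ?Q P = {?r `` {(\<zero>\<^bsub>?Q\<^esub>, \<one>)}}"
          using zero_mem unfolding localization_def quotient_def by auto
        with ne show False by simp
      qed
    next
      assume IP: "I \<subseteq> P"
      show "localization R ?Q P \<noteq> {?r `` {(\<zero>\<^bsub>?Q\<^esub>, \<one>)}}"
      proof
        assume eq: "localization R ?Q P = {?r `` {(\<zero>\<^bsub>?Q\<^esub>, \<one>)}}"
        have "(I +> \<one>, \<one>) \<in> carrier ?Q \<times> (carrier R - P)" using one carr by auto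
        hence "?r `` {(I +> \<one>, \<one>)} \<in> localization R ?Q P"
          unfolding localization_def by (rule quotientI)
        hence "?r `` {(I +> \<one>, \<one>)} = ?r `` {(I +> \<zero>, \<one>)}" using eq zero by simp
        \<comment> \<open>Reflexivity at \<open>1/1\<close> turns the equality of the classes of
          \<open>1/1\<close> and \<open>0/1\<close> into a related pair, whose witness
          \<open>u\<close> has its negative in \<open>I\<close>.\<close>
        moreover have "\<one> \<otimes> (\<one> \<otimes> \<one> \<ominus> \<one> \<otimes> \<one>) \<in> I"
          using I.zero_closed by (simp add: a_minus_def r_neg)
        hence "((I +> \<one>, \<one>), (I +> \<one>, \<one>)) \<in> ?r"
          using one by (subst rel) blast+
        ultimately have "((I +> \<zero>, \<one>), (I +> \<one>, \<one>)) \<in> ?r" by blast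
        then obtain u where u: "u \<in> carrier R" "u \<notin> P" "u \<otimes> (\<one> \<otimes> \<zero> \<ominus> \<one> \<otimes> \<one>) \<in> I"
          by (auto simp: rel)
        have "u = \<ominus> (u \<otimes> (\<one> \<otimes> \<zero> \<ominus> \<one> \<otimes> \<one>))" using u(1) by algebra
        also have "\<dots> \<in> I" using u(3) by (rule I.a_inv_closed)
        finally show False using IP u(2) by blast
      qed
    qed
  qed
  thus ?thesis by (auto simp: Supp_def Spec_def)
qed

text \<open>A closed set containing the generic point \<open>Q\<close> contains the whole hull, so
  the piece of a decomposition to which \<open>Q\<close> belongs is everything.\<close>

lemma (in cring) irreducible_closed_prime_hull:
  assumes "primeideal Q R"
  shows "irreducible_closed R {P \<in> Spec R. Q \<subseteq> P}"
proof -
  have Q: "Q \<in> {P \<in> Spec R. Q \<subseteq> P}" using assms by (simp add: Spec_def)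
  have *: "{P \<in> Spec R. Q \<subseteq> P} \<subseteq> A" if "zariski_closed R A" "Q \<in> A" for A
    using that by (auto simp: zariski_closed_def)
  have "zariski_closed R {P \<in> Spec R. Q \<subseteq> P}"
    using assms by (auto simp: zariski_closed_def primeideal_def)
  thus ?thesis unfolding irreducible_closed_def using Q * by blast
qed

text \<open>If \<open>a \<otimes> b\<close> lies in every member of \<open>Z\<close>, then
  \<open>Z\<close> is the union of its closed parts where \<open>a\<close>, respectively
  \<open>b\<close>, vanishes. Irreducibility makes one part all of \<open>Z\<close>, so the
  intersection is prime.\<close>

lemma (in cring) irreducible_closed_generic_point:
  assumes Z: "irreducible_closed R Z"
  shows "\<Inter>Z \<in> Z"
proof -
  obtain I where I: "ideal I R" "Z = {P \<in> Spec R. I \<subseteq> P}"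
    using Z by (auto simp: irreducible_closed_def zariski_closed_def)
  have prime: "P \<in> Z \<Longrightarrow> primeideal P R" for P using I by (simp add: Spec_def)
  have ne: "Z \<noteq> {}" using Z by (simp add: irreducible_closed_def)
  have id: "ideal (\<Inter>Z) R"
    using ne prime by (intro i_Intersect) (auto dest: primeideal.axioms(1))
  have closed: "zariski_closed R {P \<in> Z. a \<in> P}" if a: "a \<in> carrier R" for a
  proof -
    have sub: "I \<union> {a} \<subseteq> carrier R" using a I(1) ideal.Icarr by fastforce
    have "Idl (I \<union> {a}) \<subseteq> P \<longleftrightarrow> I \<subseteq> P \<and> a \<in> P" if "primeideal P R" for P
      using Idl_subset_ideal[OF primeideal.axioms(1)[OF that] sub] by auto
    hence "{P \<in> Z. a \<in> P} = {P \<in> Spec R. Idl (I \<union> {a}) \<subseteq> P}"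
      unfolding I(2) Spec_def by auto
    thus ?thesis unfolding zariski_closed_def using genideal_ideal[OF sub] by blast
  qed
  have "primeideal (\<Inter>Z) R"
  proof (rule primeidealI[OF id is_cring])
    show "carrier R \<noteq> \<Inter>Z" using ne prime primeideal_one by blast
  next
    fix a b assume ab: "a \<in> carrier R" "b \<in> carrier R" "a \<otimes> b \<in> \<Inter>Z"
    have "Z = {P \<in> Z. a \<in> P} \<union> {P \<in> Z. b \<in> P}"
      using ab prime primeideal.I_prime by fastforce
    hence "Z = {P \<in> Z. a \<in> P} \<or> Z = {P \<in> Z. b \<in> P}"
      using Z closed ab unfolding irreducible_closed_def by blast
    thus "a \<in> \<Inter>Z \<or> b \<in> \<Inter>Z" by blast
  qed
  thus ?thesis using I by (auto simp: Spec_def)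
qed

text \<open>Each minimal prime is the generic point of an irreducible piece containing it;
  conversely, the hulls of the minimal primes cover the support because every prime over
  \<open>X\<close> contains a minimal one. From here on the argument deals with minimal primes
  only.\<close>

lemma (in cring) fgfc_ring_iff:
  "fgfc_ring R \<longleftrightarrow> (\<forall>X. finite X \<longrightarrow> X \<subseteq> carrier R \<longrightarrow> finite (minimal_primes R X))"
proof -
  have "(\<exists>\<F>. finite \<F> \<and> (\<forall>Z\<in>\<F>. irreducible_closed R Z) \<and>
      Supp R (quotient_module (ring_as_module R) (Idl X)) = \<Union>\<F>) \<longleftrightarrow> finite (minimal_primes R X)"
    if X: "X \<subseteq> carrier R" for X
  proof -
    have "Idl X \<subseteq> P \<longleftrightarrow> X \<subseteq> P" if "primeideal P R" for P
      using Idl_subset_ideal[OF primeideal.axioms(1)[OF that] X] .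
    hence Supp: "Supp R (quotient_module (ring_as_module R) (Idl X)) = {P \<in> Spec R. X \<subseteq> P}"
      using X by (auto simp: Supp_cyclic genideal_ideal Spec_def)
    show ?thesis unfolding Supp
    proof
      assume "\<exists>\<F>. finite \<F> \<and> (\<forall>Z\<in>\<F>. irreducible_closed R Z) \<and> {P \<in> Spec R. X \<subseteq> P} = \<Union>\<F>"
      then obtain \<F> where F: "finite \<F>" "\<And>Z. Z \<in> \<F> \<Longrightarrow> irreducible_closed R Z"
        "{P \<in> Spec R. X \<subseteq> P} = \<Union>\<F>" by blast
      have "P \<in> Inter ` \<F>" if P: "P \<in> minimal_primes R X" for P
      proof -
        have "P \<in> {P \<in> Spec R. X \<subseteq> P}" using P by (simp add: minimal_primes_def Spec_def)
        then obtain Z where Z: "Z \<in> \<F>" "P \<in> Z" using F(3) by blast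
        have "\<Inter>Z \<in> {P \<in> Spec R. X \<subseteq> P}"
          using irreducible_closed_generic_point[OF F(2)[OF Z(1)]] Z(1) F(3) by blast
        hence "\<Inter>Z = P" using P Z(2) by (auto simp: minimal_primes_def Spec_def)
        thus ?thesis using Z(1) by blast
      qed
      hence "minimal_primes R X \<subseteq> Inter ` \<F>" by blast
      thus "finite (minimal_primes R X)" using F(1) by (rule finite_subset[OF _ finite_imageI])
    next
      assume fin: "finite (minimal_primes R X)"
      have "{P \<in> Spec R. X \<subseteq> P} = \<Union>((\<lambda>Q. {P \<in> Spec R. Q \<subseteq> P}) ` minimal_primes R X)"
      proof (intro equalityI subsetI)
        fix P assume P: "P \<in> {P \<in> Spec R. X \<subseteq> P}"
        hence "primeideal P R" "X \<subseteq> P" by (simp_all add: Spec_def)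
        then obtain Q where "Q \<in> minimal_primes R X" "Q \<subseteq> P" by (rule exists_minimal_prime)
        thus "P \<in> \<Union>((\<lambda>Q. {P \<in> Spec R. Q \<subseteq> P}) ` minimal_primes R X)" using P by blast
      qed (auto simp: minimal_primes_def)
      moreover have "irreducible_closed R {P \<in> Spec R. Q \<subseteq> P}" if "Q \<in> minimal_primes R X" for Q
        using that by (intro irreducible_closed_prime_hull) (simp add: minimal_primes_def)
      ultimately show "\<exists>\<F>. finite \<F> \<and> (\<forall>Z\<in>\<F>. irreducible_closed R Z) \<and>
          {P \<in> Spec R. X \<subseteq> P} = \<Union>\<F>"
        using fin by (intro exI[of _ "(\<lambda>Q. {P \<in> Spec R. Q \<subseteq> P}) ` minimal_primes R X"]) auto
    qed
  qed
  moreover have "fgfc_ring R \<longleftrightarrow> (\<forall>X. finite X \<longrightarrow> X \<subseteq> carrier R \<longrightarrow>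
      (\<exists>\<F>. finite \<F> \<and> (\<forall>Z\<in>\<F>. irreducible_closed R Z) \<and>
      Supp R (quotient_module (ring_as_module R) (Idl X)) = \<Union>\<F>))"
    unfolding fgfc_ring_def fgfc_module_def fg_submodule_ring_as_module_iff
    using is_cring by blast
  ultimately show ?thesis by simp
qed

section \<open>Gaussian elimination and generic torsion-freeness\<close>

text \<open>The vectors that are, on the coordinates in \<open>A\<close>, congruent modulo \<open>P\<close> to a linear combination
  of \<open>G\<close>; the coordinates outside \<open>A\<close> are irrelevant.\<close>

inductive_set span_mod ::
    "('a, 'm) ring_scheme \<Rightarrow> 'i set \<Rightarrow> ('i \<Rightarrow> 'a) set \<Rightarrow> 'a set \<Rightarrow> ('i \<Rightarrow> 'a) set"
  for R (structure) and A G P where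
    zero_mod: "\<forall>i\<in>A. v i \<in> P \<Longrightarrow> v \<in> span_mod R A G P"
  | gen: "l \<in> G \<Longrightarrow> \<forall>i\<in>A. v i = l i \<Longrightarrow> v \<in> span_mod R A G P"
  | add: "x \<in> span_mod R A G P \<Longrightarrow> y \<in> span_mod R A G P \<Longrightarrow> \<forall>i\<in>A. v i = x i \<oplus> y i \<Longrightarrow>
      v \<in> span_mod R A G P"
  | smult: "r \<in> carrier R \<Longrightarrow> x \<in> span_mod R A G P \<Longrightarrow> \<forall>i\<in>A. v i = r \<otimes> x i \<Longrightarrow>
      v \<in> span_mod R A G P"

text \<open>Torsion-freeness of the localization at \<open>P\<close> of the quotient of the free module by the span of
  \<open>G\<close> and \<open>P'\<close>, over the local domain \<open>R\<^sub>P / P'\<close>.\<close>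

definition torsion_free_at ::
    "('a, 'm) ring_scheme \<Rightarrow> 'i set \<Rightarrow> ('i \<Rightarrow> 'a) set \<Rightarrow> 'a set \<Rightarrow> 'a set \<Rightarrow> bool" where
  "torsion_free_at R A G P P' \<longleftrightarrow>
    (\<forall>v b. v \<in> A \<rightarrow> carrier R \<longrightarrow> b \<in> carrier R - P' \<longrightarrow>
      (\<lambda>j. b \<otimes>\<^bsub>R\<^esub> v j) \<in> span_mod R A G P' \<longrightarrow>
      (\<exists>s\<in>carrier R - P. (\<lambda>j. s \<otimes>\<^bsub>R\<^esub> v j) \<in> span_mod R A G P'))"

text \<open>A division-free row operation: it clears coordinate \<open>i\<close> of \<open>l\<close>
  by the pivot \<open>k i\<close>, which becomes invertible only after localization.\<close>

definition eliminate ::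
    "('a, 'm) ring_scheme \<Rightarrow> ('i \<Rightarrow> 'a) \<Rightarrow> 'i \<Rightarrow> ('i \<Rightarrow> 'a) \<Rightarrow> 'i \<Rightarrow> 'a" where
  "eliminate R k i l = (\<lambda>j. k i \<otimes>\<^bsub>R\<^esub> l j \<ominus>\<^bsub>R\<^esub> l i \<otimes>\<^bsub>R\<^esub> k j)"

context cring
begin

lemma span_mod_generator: "l \<in> G \<Longrightarrow> l \<in> span_mod R A G P"
  by (rule span_mod.gen) auto

lemma span_mod_closed:
  assumes "G \<subseteq> A \<rightarrow> carrier R" "P \<subseteq> carrier R" "x \<in> span_mod R A G P"
  shows "x \<in> A \<rightarrow> carrier R"
  using assms(3) by induction (use assms(1,2) in \<open>auto simp: Pi_def subset_iff\<close>)

text \<open>Eliminated generators are combinations of members of \<open>G\<close>. Membership over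
  \<open>A - {i}\<close> says nothing about coordinate \<open>i\<close>, which is therefore reset to
  the value that elimination produces there.\<close>

lemma span_mod_eliminateD:
  assumes G: "G \<subseteq> A \<rightarrow> carrier R" and P: "ideal P R" and k: "k \<in> G" and i: "i \<in> A"
    and x: "x \<in> span_mod R (A - {i}) (eliminate R k i ` G) P"
  shows "x(i := \<zero>) \<in> span_mod R A G P"
  using x
proof induction
  case (zero_mod v)
  interpret ideal P R by fact
  show ?case by (rule span_mod.zero_mod) (use zero_mod in auto)
next
  case (gen l v)
  then obtain m where m: "m \<in> G" "l = eliminate R k i m" by blast
  have mk: "\<And>j. j \<in> A \<Longrightarrow> m j \<in> carrier R" "\<And>j. j \<in> A \<Longrightarrow> k j \<in> carrier R" using G m(1) k by auto
  have "(\<lambda>j. k i \<otimes> m j) \<in> span_mod R A G P"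
    by (rule span_mod.smult[where r = "k i", OF _ span_mod_generator[OF m(1)]]) (use mk i in auto)
  moreover have "(\<lambda>j. \<ominus> m i \<otimes> k j) \<in> span_mod R A G P"
    by (rule span_mod.smult[where r = "\<ominus> m i", OF _ span_mod_generator[OF k]]) (use mk i in auto)
  moreover have "\<forall>j\<in>A. (v(i := \<zero>)) j = k i \<otimes> m j \<oplus> \<ominus> m i \<otimes> k j"
    using gen(2) mk i m_comm[of "m i" "k i"]
    by (auto simp: m(2) eliminate_def a_minus_def l_minus r_neg)
  ultimately show ?case by (rule span_mod.add)
next
  case (add x y v)
  show ?case by (rule span_mod.add[OF add.IH]) (use add.hyps in auto)
next
  case (smult r x v)
  show ?case by (rule span_mod.smult[OF smult.hyps(1) smult.IH]) (use smult.hyps in auto)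
qed

text \<open>The pivot times a generator \<open>l\<close> is its eliminated form plus
  \<open>l i\<close> times \<open>k\<close>. Hence the pivot times a combination is \<open>e\<close>
  times \<open>k\<close> plus a combination of eliminated generators, where \<open>e\<close> is
  coordinate \<open>i\<close> of the combination without its summands in \<open>P\<close>.\<close>

lemma span_mod_eliminateI:
  assumes G: "G \<subseteq> A \<rightarrow> carrier R" and P: "ideal P R" and k: "k \<in> G" and i: "i \<in> A"
    and x: "x \<in> span_mod R A G P"
  shows "\<exists>e\<in>carrier R. k i \<otimes> x i \<ominus> e \<otimes> k i \<in> P \<and>
    (\<lambda>j. k i \<otimes> x j \<ominus> e \<otimes> k j) \<in> span_mod R (A - {i}) (eliminate R k i ` G) P"
  using x
proof induction
  case (zero_mod v)
  interpret ideal P R by fact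
  have "k i \<otimes> v j \<ominus> \<zero> \<otimes> k j \<in> P" if "j \<in> A" for j
  proof -
    have c: "k i \<in> carrier R" "k j \<in> carrier R" "v j \<in> carrier R"
      using G k i that zero_mod Icarr by auto
    hence "k i \<otimes> v j \<ominus> \<zero> \<otimes> k j = k i \<otimes> v j" by algebra
    thus ?thesis using I_l_closed zero_mod that c by simp
  qed
  thus ?case using i by (intro bexI[of _ \<zero>] conjI span_mod.zero_mod) auto
next
  case (gen l v)
  interpret ideal P R by fact
  have c: "k i \<in> carrier R" "l i \<in> carrier R" using G gen(1) k i by auto
  have "k i \<otimes> v i \<ominus> l i \<otimes> k i = \<zero>"
    using c i gen(2) by (simp add: m_comm[of "l i"] a_minus_def r_neg)
  moreover have "(\<lambda>j. k i \<otimes> v j \<ominus> l i \<otimes> k j) \<in> span_mod R (A - {i}) (eliminate R k i ` G) P"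
    by (rule span_mod.gen[of "eliminate R k i l"]) (use gen in \<open>auto simp: eliminate_def\<close>)
  ultimately show ?case using c by (intro bexI[of _ "l i"]) auto
next
  case (add x y v)
  interpret ideal P R by fact
  from add.IH obtain e f where
    e: "e \<in> carrier R" "k i \<otimes> x i \<ominus> e \<otimes> k i \<in> P"
      "(\<lambda>j. k i \<otimes> x j \<ominus> e \<otimes> k j) \<in> span_mod R (A - {i}) (eliminate R k i ` G) P" and
    f: "f \<in> carrier R" "k i \<otimes> y i \<ominus> f \<otimes> k i \<in> P"
      "(\<lambda>j. k i \<otimes> y j \<ominus> f \<otimes> k j) \<in> span_mod R (A - {i}) (eliminate R k i ` G) P" by blast
  have eq: "k i \<otimes> v j \<ominus> (e \<oplus> f) \<otimes> k j = (k i \<otimes> x j \<ominus> e \<otimes> k j) \<oplus> (k i \<otimes> y j \<ominus> f \<otimes> k j)"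
    if "j \<in> A" for j
  proof -
    have c: "k i \<in> carrier R" "k j \<in> carrier R" "x j \<in> carrier R" "y j \<in> carrier R"
      using G k i that span_mod_closed[OF G _ add.hyps(1)] span_mod_closed[OF G _ add.hyps(2)]
        a_subset by (auto simp: Pi_def)
    have "v j = x j \<oplus> y j" using add.hyps that by simp
    with c e(1) f(1) show ?thesis by algebra
  qed
  have "(\<lambda>j. k i \<otimes> v j \<ominus> (e \<oplus> f) \<otimes> k j) \<in> span_mod R (A - {i}) (eliminate R k i ` G) P"
    by (rule span_mod.add[OF e(3) f(3)]) (use eq in auto)
  moreover have "k i \<otimes> v i \<ominus> (e \<oplus> f) \<otimes> k i \<in> P" using eq[OF i] e(2) f(2) by simp
  ultimately show ?case using e(1) f(1) by (intro bexI[of _ "e \<oplus> f"]) auto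
next
  case (smult r x v)
  interpret ideal P R by fact
  from smult.IH obtain e where
    e: "e \<in> carrier R" "k i \<otimes> x i \<ominus> e \<otimes> k i \<in> P"
      "(\<lambda>j. k i \<otimes> x j \<ominus> e \<otimes> k j) \<in> span_mod R (A - {i}) (eliminate R k i ` G) P" by blast
  have eq: "k i \<otimes> v j \<ominus> (r \<otimes> e) \<otimes> k j = r \<otimes> (k i \<otimes> x j \<ominus> e \<otimes> k j)" if "j \<in> A" for j
  proof -
    have c: "k i \<in> carrier R" "k j \<in> carrier R" "x j \<in> carrier R"
      using G k i that span_mod_closed[OF G _ smult.hyps(2)] a_subset by (auto simp: Pi_def)
    have "v j = r \<otimes> x j" using smult.hyps that by simp
    with c e(1) smult.hyps(1) show ?thesis by algebra
  qed
  have "(\<lambda>j. k i \<otimes> v j \<ominus> (r \<otimes> e) \<otimes> k j) \<in> span_mod R (A - {i}) (eliminate R k i ` G) P"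
    by (rule span_mod.smult[OF smult.hyps(1) e(3)]) (use eq in auto)
  moreover have "k i \<otimes> v i \<ominus> (r \<otimes> e) \<otimes> k i \<in> P"
    using eq[OF i] e(2) smult.hyps(1) I_l_closed by simp
  ultimately show ?case using e(1) smult.hyps(1) by (intro bexI[of _ "r \<otimes> e"]) auto
qed

text \<open>Since \<open>k i\<close> is a unit at \<open>P\<close>, the relation \<open>k\<close>
  expresses coordinate \<open>i\<close> through the others, so the cokernels over \<open>A\<close>
  and \<open>A - {i}\<close> agree after localization.\<close>

lemma torsion_free_at_eliminate:
  assumes G: "G \<subseteq> A \<rightarrow> carrier R" and k: "k \<in> G" and i: "i \<in> A"
    and P: "primeideal P R" and P': "primeideal P' R" "P' \<subseteq> P" and ki: "k i \<notin> P"
    and tf: "torsion_free_at R (A - {i}) (eliminate R k i ` G) P P'"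
  shows "torsion_free_at R A G P P'"
  unfolding torsion_free_at_def
proof (intro allI impI)
  let ?B = "A - {i}" and ?G = "eliminate R k i ` G"
  interpret P: primeideal P R by fact
  interpret P': primeideal P' R by fact
  fix v b
  assume v: "v \<in> A \<rightarrow> carrier R" and b: "b \<in> carrier R - P'"
    and bv: "(\<lambda>j. b \<otimes> v j) \<in> span_mod R A G P'"
  have c: "k i \<in> carrier R" "v i \<in> carrier R" "b \<in> carrier R" using v k G i b by auto
  have cj: "k j \<in> carrier R" "v j \<in> carrier R" if "j \<in> A" for j using that v k G by auto
  \<comment> \<open>The pivot times \<open>v\<close>, corrected by a multiple of the relation
    \<open>k\<close> so that coordinate \<open>i\<close> vanishes.\<close>
  define w where "w = (\<lambda>j. k i \<otimes> v j \<ominus> v i \<otimes> k j)"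
  obtain e where e: "e \<in> carrier R" "k i \<otimes> (b \<otimes> v i) \<ominus> e \<otimes> k i \<in> P'"
      "(\<lambda>j. k i \<otimes> (b \<otimes> v j) \<ominus> e \<otimes> k j) \<in> span_mod R ?B ?G P'"
    using span_mod_eliminateI[OF G P'.is_ideal k i bv] by blast
  \<comment> \<open>The pivot is outside \<open>P'\<close> as well and can be cancelled modulo
    \<open>P'\<close>, so \<open>e\<close> may be exchanged for
    \<open>b \<otimes> v i\<close>.\<close>
  have "k i \<otimes> (e \<ominus> b \<otimes> v i) = \<ominus> (k i \<otimes> (b \<otimes> v i) \<ominus> e \<otimes> k i)" using c e(1) by algebra
  also have "\<dots> \<in> P'" using e(2) by (rule P'.a_inv_closed)
  finally have eb: "e \<ominus> b \<otimes> v i \<in> P'"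
    using P'.I_prime[of "k i" "e \<ominus> b \<otimes> v i"] c e(1) ki P'(2) by auto
  have wc: "w \<in> ?B \<rightarrow> carrier R" using c cj by (auto simp: w_def)
  have "(\<lambda>j. (e \<ominus> b \<otimes> v i) \<otimes> k j) \<in> span_mod R ?B ?G P'"
    by (rule span_mod.zero_mod) (use eb cj P'.I_r_closed in auto)
  moreover have "b \<otimes> w j = (k i \<otimes> (b \<otimes> v j) \<ominus> e \<otimes> k j) \<oplus> (e \<ominus> b \<otimes> v i) \<otimes> k j" if "j \<in> A" for j
    using c cj[OF that] e(1) unfolding w_def by algebra
  hence "\<forall>j\<in>?B. b \<otimes> w j = (k i \<otimes> (b \<otimes> v j) \<ominus> e \<otimes> k j) \<oplus> (e \<ominus> b \<otimes> v i) \<otimes> k j" by blast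
  ultimately have "(\<lambda>j. b \<otimes> w j) \<in> span_mod R ?B ?G P'" by (rule span_mod.add[OF e(3)])
  then obtain s where s: "s \<in> carrier R - P" "(\<lambda>j. s \<otimes> w j) \<in> span_mod R ?B ?G P'"
    using tf wc b unfolding torsion_free_at_def by blast
  have "w i = \<zero>" using c unfolding w_def by algebra
  hence "(\<lambda>j. s \<otimes> w j)(i := \<zero>) = (\<lambda>j. s \<otimes> w j)" using s(1) by auto
  hence sw: "(\<lambda>j. s \<otimes> w j) \<in> span_mod R A G P'"
    using span_mod_eliminateD[OF G P'.is_ideal k i s(2)] by simp
  have "(\<lambda>j. (s \<otimes> v i) \<otimes> k j) \<in> span_mod R A G P'"
    by (rule span_mod.smult[where r = "s \<otimes> v i", OF _ span_mod_generator[OF k]])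
      (use s(1) c in auto)
  \<comment> \<open>Undoing the correction costs a factor \<open>k i\<close>, so the multiplier for
    \<open>v\<close> is \<open>s \<otimes> k i\<close>, which is still outside
    \<open>P\<close>.\<close>
  moreover have "(s \<otimes> k i) \<otimes> v j = s \<otimes> w j \<oplus> (s \<otimes> v i) \<otimes> k j" if "j \<in> A" for j
    using c cj[OF that] s(1) unfolding w_def Diff_iff by algebra
  hence "\<forall>j\<in>A. (s \<otimes> k i) \<otimes> v j = s \<otimes> w j \<oplus> (s \<otimes> v i) \<otimes> k j" by blast
  ultimately have "(\<lambda>j. (s \<otimes> k i) \<otimes> v j) \<in> span_mod R A G P'" by (rule span_mod.add[OF sw])
  moreover have "s \<otimes> k i \<in> carrier R - P" using s(1) c(1) ki P.I_prime by blast
  ultimately show "\<exists>s\<in>carrier R - P. (\<lambda>j. s \<otimes> v j) \<in> span_mod R A G P'" by blast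
qed

text \<open>The span is zero modulo \<open>P'\<close>, so the quotient is already free over the
  domain \<open>R / P'\<close>, and \<open>s\<close> can be \<open>\<one>\<close>.\<close>

lemma torsion_free_at_trivial:
  assumes G: "G \<subseteq> A \<rightarrow> carrier R" and P: "primeideal P R" and P': "primeideal P' R"
    and sub: "(\<Union>l\<in>G. l ` A) \<subseteq> P'"
  shows "torsion_free_at R A G P P'"
proof -
  interpret P': primeideal P' R by fact
  have *: "\<forall>j\<in>A. x j \<in> P'" if "x \<in> span_mod R A G P'" for x
    using that by induction (use sub P'.I_l_closed in auto)
  have one: "\<one> \<in> carrier R - P" using primeideal_one[OF P] by simp
  show ?thesis unfolding torsion_free_at_def
  proof (intro allI impI)
    fix v b assume v: "v \<in> A \<rightarrow> carrier R" "b \<in> carrier R - P'" "(\<lambda>j. b \<otimes> v j) \<in> span_mod R A G P'"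
    have "v j \<in> P'" if "j \<in> A" for j
      using *[OF v(3)] v(1,2) that P'.I_prime[of b "v j"] by (auto simp: Pi_def)
    hence "(\<lambda>j. \<one> \<otimes> v j) \<in> span_mod R A G P'" using v(1) by (intro span_mod.zero_mod) auto
    thus "\<exists>s\<in>carrier R - P. (\<lambda>j. s \<otimes> v j) \<in> span_mod R A G P'" using one by blast
  qed
qed

text \<open>Each prime \<open>P\<close> either contains all entries of \<open>G\<close>, or some entry is outside of \<open>P\<close> and can be
  used as a pivot.\<close>

lemma finite_stratification:
  assumes "finite A" "finite G" "G \<subseteq> A \<rightarrow> carrier R"
  shows "\<exists>\<X>. finite \<X> \<and> (\<forall>X\<in>\<X>. finite X \<and> X \<subseteq> carrier R) \<and>
    (\<forall>P. primeideal P R \<longrightarrow> (\<exists>X\<in>\<X>. X \<subseteq> P \<and>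
      (\<forall>P'. primeideal P' R \<longrightarrow> X \<subseteq> P' \<longrightarrow> P' \<subseteq> P \<longrightarrow> torsion_free_at R A G P P')))"
  using assms
proof (induction A arbitrary: G rule: finite_psubset_induct)
  case (psubset A)
  let ?strat = "\<lambda>B H \<X>. finite \<X> \<and> (\<forall>X\<in>\<X>. finite X \<and> X \<subseteq> carrier R) \<and>
    (\<forall>P. primeideal P R \<longrightarrow> (\<exists>X\<in>\<X>. X \<subseteq> P \<and>
      (\<forall>P'. primeideal P' R \<longrightarrow> X \<subseteq> P' \<longrightarrow> P' \<subseteq> P \<longrightarrow> torsion_free_at R B H P P')))"
  have "\<forall>k\<in>G. \<forall>i\<in>A. \<exists>\<X>. ?strat (A - {i}) (eliminate R k i ` G) \<X>"
  proof (intro ballI)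
    fix k i assume ki: "k \<in> G" "i \<in> A"
    have "eliminate R k i ` G \<subseteq> A - {i} \<rightarrow> carrier R"
      using psubset.prems(2) ki by (auto simp: eliminate_def Pi_def subset_iff)
    thus "\<exists>\<X>. ?strat (A - {i}) (eliminate R k i ` G) \<X>"
      using psubset.prems(1) ki by (intro psubset.IH) auto
  qed
  then obtain F where F: "\<forall>k\<in>G. \<forall>i\<in>A. ?strat (A - {i}) (eliminate R k i ` G) (F k i)"
    unfolding bchoice_iff by blast
  \<comment> \<open>The inserted set belongs to the case without a pivot; the others come from
    recursion on the coordinates that a pivot leaves. Only vanishing is recorded: a pivot outside
    \<open>P\<close> is outside every \<open>P' \<subseteq> P\<close>.\<close>
  define \<X> where "\<X> = insert (\<Union>l\<in>G. l ` A) (\<Union>k\<in>G. \<Union>i\<in>A. F k i)"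
  have "finite \<X>" using F psubset.hyps psubset.prems(1) by (auto simp: \<X>_def)
  moreover have "\<forall>X\<in>\<X>. finite X \<and> X \<subseteq> carrier R"
    using F psubset.hyps psubset.prems by (auto simp: \<X>_def Pi_def subset_iff)
  moreover have "\<exists>X\<in>\<X>. X \<subseteq> P \<and>
      (\<forall>P'. primeideal P' R \<longrightarrow> X \<subseteq> P' \<longrightarrow> P' \<subseteq> P \<longrightarrow> torsion_free_at R A G P P')"
    if P: "primeideal P R" for P
  proof (cases "(\<Union>l\<in>G. l ` A) \<subseteq> P")
    case True
    thus ?thesis using torsion_free_at_trivial[OF psubset.prems(2) P] by (auto simp: \<X>_def)
  next
    case False
    then obtain k i where ki: "k \<in> G" "i \<in> A" "k i \<notin> P" by blast
    obtain X where X: "X \<in> F k i" "X \<subseteq> P"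
      "\<And>P'. primeideal P' R \<Longrightarrow> X \<subseteq> P' \<Longrightarrow> P' \<subseteq> P \<Longrightarrow>
        torsion_free_at R (A - {i}) (eliminate R k i ` G) P P'"
      using F ki(1,2) P by meson
    have "torsion_free_at R A G P P'" if "primeideal P' R" "X \<subseteq> P'" "P' \<subseteq> P" for P'
      using torsion_free_at_eliminate[OF psubset.prems(2) ki(1,2) P that(1,3) ki(3) X(3)[OF that]] .
    moreover have "X \<in> \<X>" using X(1) ki by (auto simp: \<X>_def)
    ultimately show ?thesis using X(2) by blast
  qed
  ultimately show ?case by blast
qed

end

section \<open>Fibres of a finite ring homomorphism\<close>

definition contraction :: "('a, 'm) ring_scheme \<Rightarrow> ('a \<Rightarrow> 'b) \<Rightarrow> 'b set \<Rightarrow> 'a set" where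
  "contraction R f Q = {r \<in> carrier R. f r \<in> Q}"

text \<open>The coefficient of the last generator is exposed because the fibre bound is proved by
  induction on the number of generators.\<close>

primrec partial_span ::
    "('a, 'm) ring_scheme \<Rightarrow> ('b, 'n) ring_scheme \<Rightarrow> ('a \<Rightarrow> 'b) \<Rightarrow> (nat \<Rightarrow> 'b) \<Rightarrow> nat \<Rightarrow> 'b set" where
  "partial_span R S f g 0 = {\<zero>\<^bsub>S\<^esub>}"
| "partial_span R S f g (Suc m) =
    {f r \<otimes>\<^bsub>S\<^esub> g m \<oplus>\<^bsub>S\<^esub> x | r x. r \<in> carrier R \<and> x \<in> partial_span R S f g m}"

lemma (in ideal) minus_mem: "a \<in> I \<Longrightarrow> b \<in> I \<Longrightarrow> a \<ominus> b \<in> I"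
  by (simp add: minus_eq a_closed a_inv_closed)

context ring_hom_cring
begin

lemma primeideal_contraction:
  assumes "primeideal Q S"
  shows "primeideal (contraction R h Q) R"
proof -
  interpret Q: primeideal Q S by fact
  show ?thesis
  proof (rule primeidealI[OF idealI[OF R.ring_axioms] R.is_cring])
    show "subgroup (contraction R h Q) (add_monoid R)"
      by (rule R.add.subgroupI) (auto simp: contraction_def a_inv_def[symmetric])
    show "x \<otimes> a \<in> contraction R h Q" "a \<otimes> x \<in> contraction R h Q"
      if "a \<in> contraction R h Q" "x \<in> carrier R" for a x
      using that Q.I_l_closed Q.I_r_closed by (auto simp: contraction_def)
    show "carrier R \<noteq> contraction R h Q"
    proof
      assume "carrier R = contraction R h Q"
      hence "\<one> \<in> contraction R h Q" using R.one_closed by simp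
      thus False using primeideal_one[OF assms] by (simp add: contraction_def)
    qed
    show "a \<in> contraction R h Q \<or> b \<in> contraction R h Q"
      if "a \<in> carrier R" "b \<in> carrier R" "a \<otimes> b \<in> contraction R h Q" for a b
      using that Q.I_prime[of "h a" "h b"] by (auto simp: contraction_def)
  qed
qed

lemma partial_span_closed:
  assumes "g \<in> {..<m} \<rightarrow> carrier S" "x \<in> partial_span R S h g m"
  shows "x \<in> carrier S"
  using assms by (induction m arbitrary: x) (auto simp: Pi_def)

lemma partial_span_diff:
  assumes "g \<in> {..<m} \<rightarrow> carrier S" "x \<in> partial_span R S h g m" "y \<in> partial_span R S h g m"
    and "r \<in> carrier R" "s \<in> carrier R"
  shows "h r \<otimes>\<^bsub>S\<^esub> x \<ominus>\<^bsub>S\<^esub> h s \<otimes>\<^bsub>S\<^esub> y \<in> partial_span R S h g m"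
  using assms(1-3)
proof (induction m arbitrary: x y)
  case 0
  thus ?case using assms(4,5) by (simp add: S.minus_eq)
next
  case (Suc m)
  from Suc.prems obtain a x' b y' where
    ab: "a \<in> carrier R" "x' \<in> partial_span R S h g m" "x = h a \<otimes>\<^bsub>S\<^esub> g m \<oplus>\<^bsub>S\<^esub> x'"
      "b \<in> carrier R" "y' \<in> partial_span R S h g m" "y = h b \<otimes>\<^bsub>S\<^esub> g m \<oplus>\<^bsub>S\<^esub> y'"
    by auto
  have g: "g \<in> {..<m} \<rightarrow> carrier S" "g m \<in> carrier S" using Suc.prems by auto
  note c = partial_span_closed[OF g(1) ab(2)] partial_span_closed[OF g(1) ab(5)] g(2)
    hom_closed[OF ab(1)] hom_closed[OF ab(4)] hom_closed[OF assms(4)] hom_closed[OF assms(5)]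
  have "h r \<otimes>\<^bsub>S\<^esub> x \<ominus>\<^bsub>S\<^esub> h s \<otimes>\<^bsub>S\<^esub> y =
      (h r \<otimes>\<^bsub>S\<^esub> h a \<ominus>\<^bsub>S\<^esub> h s \<otimes>\<^bsub>S\<^esub> h b) \<otimes>\<^bsub>S\<^esub> g m \<oplus>\<^bsub>S\<^esub> (h r \<otimes>\<^bsub>S\<^esub> x' \<ominus>\<^bsub>S\<^esub> h s \<otimes>\<^bsub>S\<^esub> y')"
    unfolding ab(3,6) using c by algebra
  also have "h r \<otimes>\<^bsub>S\<^esub> h a \<ominus>\<^bsub>S\<^esub> h s \<otimes>\<^bsub>S\<^esub> h b = h (r \<otimes> a \<ominus> s \<otimes> b)"
    using assms(4,5) ab by (simp add: S.minus_eq R.minus_eq)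
  finally have "h r \<otimes>\<^bsub>S\<^esub> x \<ominus>\<^bsub>S\<^esub> h s \<otimes>\<^bsub>S\<^esub> y =
    h (r \<otimes> a \<ominus> s \<otimes> b) \<otimes>\<^bsub>S\<^esub> g m \<oplus>\<^bsub>S\<^esub> (h r \<otimes>\<^bsub>S\<^esub> x' \<ominus>\<^bsub>S\<^esub> h s \<otimes>\<^bsub>S\<^esub> y')" .
  moreover have "r \<otimes> a \<ominus> s \<otimes> b \<in> carrier R" using assms(4,5) ab by simp
  ultimately show ?case using Suc.IH[OF g(1) ab(2,5)] by auto
qed

text \<open>The idea is that the elements \<open>e Q\<close> are linearly independent modulo \<open>P\<close>.\<close>

lemma card_separated_primes_le:
  assumes "finite \<Q>" "\<And>Q. Q \<in> \<Q> \<Longrightarrow> primeideal Q S \<and> contraction R h Q = P"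
    and "g \<in> {..<m} \<rightarrow> carrier S" "\<And>Q. Q \<in> \<Q> \<Longrightarrow> e Q \<in> partial_span R S h g m"
    and "\<And>Q. Q \<in> \<Q> \<Longrightarrow> e Q \<notin> Q"
    and "\<And>Q Q'. Q \<in> \<Q> \<Longrightarrow> Q' \<in> \<Q> \<Longrightarrow> Q' \<noteq> Q \<Longrightarrow> e Q \<in> Q'"
  shows "card \<Q> \<le> m"
  using assms
proof (induction m arbitrary: \<Q> e)
  case 0
  have "Q \<notin> \<Q>" for Q
  proof
    assume Q: "Q \<in> \<Q>"
    interpret primeideal Q S using 0(2) Q by blast
    show False using 0(4,5)[OF Q] zero_closed by simp
  qed
  hence "\<Q> = {}" by blast
  thus ?case by simp
next
  case (Suc m)
  have g: "g \<in> {..<m} \<rightarrow> carrier S" "g m \<in> carrier S" using Suc.prems(3) by auto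
  have "\<forall>Q\<in>\<Q>. \<exists>r x. r \<in> carrier R \<and> x \<in> partial_span R S h g m \<and> e Q = h r \<otimes>\<^bsub>S\<^esub> g m \<oplus>\<^bsub>S\<^esub> x"
    using Suc.prems(4) by fastforce
  then obtain r x where rx: "\<And>Q. Q \<in> \<Q> \<Longrightarrow> r Q \<in> carrier R"
    "\<And>Q. Q \<in> \<Q> \<Longrightarrow> x Q \<in> partial_span R S h g m"
    "\<And>Q. Q \<in> \<Q> \<Longrightarrow> e Q = h (r Q) \<otimes>\<^bsub>S\<^esub> g m \<oplus>\<^bsub>S\<^esub> x Q"
    unfolding bchoice_iff by blast
  have xc: "x Q \<in> carrier S" and hr: "h (r Q) \<in> carrier S" if "Q \<in> \<Q>" for Q
    using rx(1,2)[OF that] partial_span_closed[OF g(1)] by auto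
  have ec: "e Q \<in> carrier S" if "Q \<in> \<Q>" for Q
    using rx(3) xc hr that g(2) by simp
  show ?case
  proof (cases "\<forall>Q\<in>\<Q>. r Q \<in> P")
    case True
    \<comment> \<open>With all coefficients of \<open>g m\<close> in \<open>P\<close>, dropping the
      \<open>g m\<close> term changes \<open>e Q\<close> by an element of every prime in
      \<open>\<Q>\<close>, so \<open>x\<close> separates the same primes with one generator
      fewer.\<close>
    have *: "e Q \<in> Q' \<longleftrightarrow> x Q \<in> Q'" if Q: "Q \<in> \<Q>" "Q' \<in> \<Q>" for Q Q'
    proof -
      interpret Q': primeideal Q' S using Suc.prems(2) Q by blast
      have "r Q \<in> contraction R h Q'" using True Suc.prems(2) Q by blast
      hence "h (r Q) \<otimes>\<^bsub>S\<^esub> g m \<in> Q'" using Q'.I_r_closed g(2) by (simp add: contraction_def)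
      moreover have "x Q = e Q \<ominus>\<^bsub>S\<^esub> h (r Q) \<otimes>\<^bsub>S\<^esub> g m"
        unfolding rx(3)[OF Q(1)] using xc hr g(2) Q by algebra
      ultimately show ?thesis using rx(3)[OF Q(1)] Q'.a_closed Q'.minus_mem by metis
    qed
    have "card \<Q> \<le> m"
      by (rule Suc.IH[of \<Q> x]) (use Suc.prems rx * g in auto)
    thus ?thesis by simp
  next
    case False
    then obtain Q0 where Q0: "Q0 \<in> \<Q>" "r Q0 \<notin> P" by blast
    \<comment> \<open>Cross-multiplication cancels the \<open>g m\<close> terms at the price of the
      prime \<open>Q0\<close>. As \<open>h (r Q0)\<close> lies in no prime of \<open>\<Q>\<close>,
      all of which contract to \<open>P\<close>, the element \<open>e' Q\<close> stays outside
      \<open>Q\<close>.\<close>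
    define e' where "e' Q = h (r Q0) \<otimes>\<^bsub>S\<^esub> e Q \<ominus>\<^bsub>S\<^esub> h (r Q) \<otimes>\<^bsub>S\<^esub> e Q0" for Q
    have e'_eq: "e' Q = h (r Q0) \<otimes>\<^bsub>S\<^esub> x Q \<ominus>\<^bsub>S\<^esub> h (r Q) \<otimes>\<^bsub>S\<^esub> x Q0" if "Q \<in> \<Q>" for Q
      unfolding e'_def rx(3)[OF that] rx(3)[OF Q0(1)] using xc hr g(2) that Q0(1) by algebra
    have "card (\<Q> - {Q0}) \<le> m"
    proof (rule Suc.IH[of _ e'])
      show "finite (\<Q> - {Q0})" using Suc.prems(1) by simp
      show "g \<in> {..<m} \<rightarrow> carrier S" by (rule g(1))
      show "primeideal Q S \<and> contraction R h Q = P" if "Q \<in> \<Q> - {Q0}" for Q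
        using Suc.prems(2) that by blast
      show "e' Q \<in> partial_span R S h g m" if "Q \<in> \<Q> - {Q0}" for Q
        using partial_span_diff[OF g(1)] rx Q0 that by (simp add: e'_eq)
      show "e' Q \<in> Q'" if Q: "Q \<in> \<Q> - {Q0}" "Q' \<in> \<Q> - {Q0}" "Q' \<noteq> Q" for Q Q'
      proof -
        interpret Q': primeideal Q' S using Suc.prems(2) Q by blast
        have "e Q \<in> Q'" "e Q0 \<in> Q'" using Suc.prems(6) Q Q0 by auto
        thus ?thesis unfolding e'_def using Q'.I_l_closed hr Q Q0 by (intro Q'.minus_mem) auto
      qed
      show "e' Q \<notin> Q" if Q: "Q \<in> \<Q> - {Q0}" for Q
      proof
        assume e': "e' Q \<in> Q"
        interpret Q: primeideal Q S using Suc.prems(2) Q by blast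
        have "e Q0 \<in> Q" using Suc.prems(6) Q Q0 by auto
        hence e0: "h (r Q) \<otimes>\<^bsub>S\<^esub> e Q0 \<in> Q" using Q.I_l_closed hr Q by simp
        have "h (r Q0) \<in> carrier S" "h (r Q) \<in> carrier S" "e Q \<in> carrier S" "e Q0 \<in> carrier S"
          using hr ec Q Q0(1) by auto
        hence "h (r Q0) \<otimes>\<^bsub>S\<^esub> e Q = e' Q \<oplus>\<^bsub>S\<^esub> h (r Q) \<otimes>\<^bsub>S\<^esub> e Q0"
          unfolding e'_def by algebra
        hence "h (r Q0) \<otimes>\<^bsub>S\<^esub> e Q \<in> Q" using Q.a_closed[OF e' e0] by simp
        moreover have "e Q \<notin> Q" using Suc.prems(5) Q by blast
        ultimately have "h (r Q0) \<in> Q"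
          using Q.I_prime[of "h (r Q0)" "e Q"] hr[OF Q0(1)] ec[of Q] Q by blast
        hence "r Q0 \<in> contraction R h Q" using rx(1) Q0 by (simp add: contraction_def)
        thus False using Suc.prems(2) Q Q0(2) by blast
      qed
    qed
    thus ?thesis using Suc.prems(1) Q0(1) by simp
  qed
qed

text \<open>Distinct minimal primes are incomparable, so any finite part of the fibre has separating
  elements and at most \<open>m\<close> members; a uniform bound on finite subsets makes the fibre
  finite.\<close>

lemma finite_fibre_of_minimal_primes:
  assumes g: "g \<in> {..<m} \<rightarrow> carrier S" "carrier S \<subseteq> partial_span R S h g m"
  shows "finite {Q \<in> minimal_primes S Y. contraction R h Q = P}" (is "finite ?F")
proof -
  have "card \<Q> \<le> m" if Q: "\<Q> \<subseteq> ?F" "finite \<Q>" for \<Q>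
  proof -
    have prime: "primeideal Q S" if "Q \<in> \<Q>" for Q using that Q(1) by (auto simp: minimal_primes_def)
    have inc: "\<not> Q' \<subseteq> Q" if "Q \<in> \<Q>" "Q' \<in> \<Q> - {Q}" for Q Q'
      using that Q(1) by (auto simp: minimal_primes_def)
    have "\<forall>Q\<in>\<Q>. \<exists>e. e \<in> carrier S \<and> e \<notin> Q \<and> (\<forall>Q'\<in>\<Q> - {Q}. e \<in> Q')"
    proof
      fix Q0 assume Q0: "Q0 \<in> \<Q>"
      have "\<exists>e\<in>carrier S. e \<notin> Q0 \<and> (\<forall>J\<in>\<Q> - {Q0}. e \<in> J)"
      proof (rule S.prime_avoids_intersection[OF _ _ prime[OF Q0]])
        show "finite (\<Q> - {Q0})" using Q(2) by simp
        show "ideal J S" if "J \<in> \<Q> - {Q0}" for J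
          using prime that by (blast intro: primeideal.axioms(1))
        show "\<not> J \<subseteq> Q0" if "J \<in> \<Q> - {Q0}" for J using inc[OF Q0 that] .
      qed
      thus "\<exists>e. e \<in> carrier S \<and> e \<notin> Q0 \<and> (\<forall>Q'\<in>\<Q> - {Q0}. e \<in> Q')" by blast
    qed
    then obtain e where e: "\<forall>Q\<in>\<Q>. e Q \<in> carrier S \<and> e Q \<notin> Q \<and> (\<forall>Q'\<in>\<Q> - {Q}. e Q \<in> Q')"
      unfolding bchoice_iff by blast
    show "card \<Q> \<le> m"
    proof (rule card_separated_primes_le[where P = P and g = g and e = e])
      show "finite \<Q>" "g \<in> {..<m} \<rightarrow> carrier S" by fact+
      show "primeideal Q S \<and> contraction R h Q = P" if "Q \<in> \<Q>" for Q
        using that prime Q(1) by blast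
      show "e Q \<in> partial_span R S h g m" "e Q \<notin> Q" if "Q \<in> \<Q>" for Q
        using that e g(2) by blast+
      show "e Q \<in> Q'" if "Q \<in> \<Q>" "Q' \<in> \<Q>" "Q' \<noteq> Q" for Q Q'
        using that e by blast
    qed
  qed
  thus ?thesis using finite_if_finite_subsets_card_bdd[of ?F m] by blast
qed

end

section \<open>Finitely presented algebras\<close>

lemma free_module_apply:
  assumes "i < n"
  shows "\<zero>\<^bsub>free_module R n\<^esub> i = \<zero>\<^bsub>R\<^esub>"
    and "(v \<oplus>\<^bsub>free_module R n\<^esub> w) i = v i \<oplus>\<^bsub>R\<^esub> w i"
    and "(r \<odot>\<^bsub>free_module R n\<^esub> v) i = r \<otimes>\<^bsub>R\<^esub> v i"
  using assms by (simp_all add: free_module_def)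

lemma free_module_mem:
  "v \<in> carrier (free_module R n) \<Longrightarrow> i < n \<Longrightarrow> v i \<in> carrier R"
  by (auto simp: free_module_def)

lemma restrict_in_free_module:
  "v \<in> {..<n} \<rightarrow> carrier R \<Longrightarrow> restrict v {..<n} \<in> carrier (free_module R n)"
  by (auto simp: free_module_def)

lemma free_module_ext:
  assumes "v \<in> carrier (free_module R n)" "w \<in> carrier (free_module R n)"
    and "\<And>i. i < n \<Longrightarrow> v i = w i"
  shows "v = w"
  using assms by (auto simp: free_module_def intro: PiE_ext)

lemma (in cring) free_module_closed:
  shows "\<zero>\<^bsub>free_module R n\<^esub> \<in> carrier (free_module R n)"
    and "v \<in> carrier (free_module R n) \<Longrightarrow> w \<in> carrier (free_module R n) \<Longrightarrow>
      v \<oplus>\<^bsub>free_module R n\<^esub> w \<in> carrier (free_module R n)"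
    and "r \<in> carrier R \<Longrightarrow> v \<in> carrier (free_module R n) \<Longrightarrow>
      r \<odot>\<^bsub>free_module R n\<^esub> v \<in> carrier (free_module R n)"
  by (auto simp: free_module_def)

lemma (in cring) free_module_module: "Module.module R (free_module R n)"
  (is "Module.module R ?F")
proof (rule moduleI)
  show "abelian_group ?F"
  proof (rule abelian_groupI)
    fix v assume v: "v \<in> carrier ?F"
    let ?w = "\<lambda>i\<in>{..<n}. \<ominus> v i"
    have w: "?w \<in> carrier ?F" using free_module_mem[OF v] by (intro restrict_in_free_module) auto
    have "?w \<oplus>\<^bsub>?F\<^esub> v = \<zero>\<^bsub>?F\<^esub>"
      by (rule free_module_ext[of _ R n])
        (use v w free_module_mem[OF v] in
          \<open>auto simp: free_module_closed free_module_apply l_neg\<close>)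
    thus "\<exists>w\<in>carrier ?F. w \<oplus>\<^bsub>?F\<^esub> v = \<zero>\<^bsub>?F\<^esub>" using w by blast
  next
    fix u v w assume c: "u \<in> carrier ?F" "v \<in> carrier ?F" "w \<in> carrier ?F"
    show "u \<oplus>\<^bsub>?F\<^esub> v \<oplus>\<^bsub>?F\<^esub> w = u \<oplus>\<^bsub>?F\<^esub> (v \<oplus>\<^bsub>?F\<^esub> w)"
      by (rule free_module_ext[of _ R n])
      (use c free_module_mem[OF c(1)] free_module_mem[OF c(2)] free_module_mem[OF c(3)] in
        \<open>auto simp: free_module_closed free_module_apply a_assoc\<close>)
  next
    fix v w assume c: "v \<in> carrier ?F" "w \<in> carrier ?F"
    show "v \<oplus>\<^bsub>?F\<^esub> w = w \<oplus>\<^bsub>?F\<^esub> v"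
      by (rule free_module_ext[of _ R n])
      (use c free_module_mem[OF c(1)] free_module_mem[OF c(2)] in
        \<open>auto simp: free_module_closed free_module_apply a_comm\<close>)
  next
    fix v assume c: "v \<in> carrier ?F"
    show "\<zero>\<^bsub>?F\<^esub> \<oplus>\<^bsub>?F\<^esub> v = v"
      by (rule free_module_ext[of _ R n])
      (use c free_module_mem[OF c] in
        \<open>auto simp: free_module_closed free_module_apply\<close>)
  qed (auto simp: free_module_closed)
next
  fix a b v assume c: "a \<in> carrier R" "b \<in> carrier R" "v \<in> carrier ?F"
  show "(a \<oplus> b) \<odot>\<^bsub>?F\<^esub> v = a \<odot>\<^bsub>?F\<^esub> v \<oplus>\<^bsub>?F\<^esub> b \<odot>\<^bsub>?F\<^esub> v"
    by (rule free_module_ext[of _ R n])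
      (use c free_module_mem[OF c(3)] in
        \<open>auto simp: free_module_closed free_module_apply l_distr\<close>)
next
  fix a v w assume c: "a \<in> carrier R" "v \<in> carrier ?F" "w \<in> carrier ?F"
  show "a \<odot>\<^bsub>?F\<^esub> (v \<oplus>\<^bsub>?F\<^esub> w) = a \<odot>\<^bsub>?F\<^esub> v \<oplus>\<^bsub>?F\<^esub> a \<odot>\<^bsub>?F\<^esub> w"
    by (rule free_module_ext[of _ R n])
      (use c free_module_mem[OF c(2)] free_module_mem[OF c(3)] in
        \<open>auto simp: free_module_closed free_module_apply r_distr\<close>)
next
  fix a b v assume c: "a \<in> carrier R" "b \<in> carrier R" "v \<in> carrier ?F"
  show "(a \<otimes> b) \<odot>\<^bsub>?F\<^esub> v = a \<odot>\<^bsub>?F\<^esub> (b \<odot>\<^bsub>?F\<^esub> v)"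
    by (rule free_module_ext[of _ R n])
      (use c free_module_mem[OF c(3)] in
        \<open>auto simp: free_module_closed free_module_apply m_assoc\<close>)
next
  fix v assume c: "v \<in> carrier ?F"
  show "\<one> \<odot>\<^bsub>?F\<^esub> v = v"
    by (rule free_module_ext[of _ R n])
      (use c free_module_mem[OF c] in
        \<open>auto simp: free_module_closed free_module_apply\<close>)
qed (auto simp: free_module_closed is_cring)

section \<open>Algebras that are finitely generated as modules\<close>

context algebra
begin

definition structure_map :: "'a \<Rightarrow> 'c" where
  "structure_map r = r \<odot>\<^bsub>M\<^esub> \<one>\<^bsub>M\<^esub>"

lemma smult_eq_structure_map:
  "r \<in> carrier R \<Longrightarrow> x \<in> carrier M \<Longrightarrow> r \<odot>\<^bsub>M\<^esub> x = structure_map r \<otimes>\<^bsub>M\<^esub> x"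
proof -
  assume "r \<in> carrier R" "x \<in> carrier M"
  thus ?thesis by (simp add: structure_map_def smult_assoc2)
qed

lemma structure_map_hom: "ring_hom_cring R M structure_map"
proof -
  have "structure_map \<in> ring_hom R M"
    by (rule ring_hom_memI)
      (auto simp: structure_map_def smult_l_distr smult_assoc1 smult_assoc2)
  thus ?thesis
    by (intro ring_hom_cring.intro R_cring M_cring ring_hom_cring_axioms.intro)
qed

end

locale generated_algebra = algebra R M for R (structure) and M (structure) +
  fixes n :: nat and h :: "(nat \<Rightarrow> 'a) \<Rightarrow> 'c"
  assumes linear: "h \<in> linear_maps R (free_module R n) M"
    and surj: "h ` carrier (free_module R n) = carrier M"
begin

abbreviation "F \<equiv> free_module R n"

definition basis_image :: "nat \<Rightarrow> 'c" where
  "basis_image m = h (\<lambda>i\<in>{..<n}. if i = m then \<one> else \<zero>)"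

lemma h_closed [simp]: "v \<in> carrier F \<Longrightarrow> h v \<in> carrier M"
  and h_add: "v \<in> carrier F \<Longrightarrow> w \<in> carrier F \<Longrightarrow> h (v \<oplus>\<^bsub>F\<^esub> w) = h v \<oplus>\<^bsub>M\<^esub> h w"
  and h_smult: "r \<in> carrier R \<Longrightarrow> v \<in> carrier F \<Longrightarrow> h (r \<odot>\<^bsub>F\<^esub> v) = r \<odot>\<^bsub>M\<^esub> h v"
  using linear by (auto simp: linear_maps_def)

lemma basis_image_closed [simp]: "basis_image m \<in> carrier M"
  unfolding basis_image_def by (intro h_closed restrict_in_free_module) auto

text \<open>The vector \<open>v\<close> is assembled one coordinate at a time. The stage index of
  \<open>N\<close> lets the same induction serve the growing sets \<open>partial_span\<close> and,
  with \<open>N\<close> constant, ideals.\<close>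

lemma h_induct:
  assumes v: "v \<in> carrier F" and zero: "\<zero>\<^bsub>M\<^esub> \<in> N 0"
    and step: "\<And>m x. m < n \<Longrightarrow> x \<in> N m \<Longrightarrow> v m \<odot>\<^bsub>M\<^esub> basis_image m \<oplus>\<^bsub>M\<^esub> x \<in> N (Suc m)"
  shows "h v \<in> N n"
proof -
  interpret F: Module.module R F by (rule R.free_module_module)
  let ?w = "\<lambda>m. \<lambda>i\<in>{..<n}. if i < m then v i else \<zero>"
  have vm: "m < n \<Longrightarrow> v m \<in> carrier R" for m using v by (rule free_module_mem)
  have w: "?w m \<in> carrier F" for m by (rule restrict_in_free_module) (use vm in auto)
  have "h (?w m) \<in> N m" if "m \<le> n" for m
    using that
  proof (induction m)
    case 0
    \<comment> \<open>\<open>linear_maps\<close> provides additivity and homogeneity; the value at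
      zero is extracted from the latter.\<close>
    have "?w 0 = \<zero> \<odot>\<^bsub>F\<^esub> \<zero>\<^bsub>F\<^esub>"
      by (rule free_module_ext[of _ R n])
        (use w[of 0] in \<open>auto simp: R.free_module_closed free_module_apply\<close>)
    hence "h (?w 0) = \<zero> \<odot>\<^bsub>M\<^esub> h \<zero>\<^bsub>F\<^esub>" by (simp only: h_smult R.zero_closed F.zero_closed)
    also have "\<dots> = \<zero>\<^bsub>M\<^esub>" using R.free_module_closed(1) by simp
    finally show ?case using zero by (rule ssubst)
  next
    case (Suc m)
    let ?e = "\<lambda>i\<in>{..<n}. if i = m then \<one> else \<zero>"
    have e: "?e \<in> carrier F" by (rule restrict_in_free_module) auto
    have "?w (Suc m) = v m \<odot>\<^bsub>F\<^esub> ?e \<oplus>\<^bsub>F\<^esub> ?w m"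
    proof (rule free_module_ext[of _ R n])
      fix i assume "i < n"
      thus "?w (Suc m) i = (v m \<odot>\<^bsub>F\<^esub> ?e \<oplus>\<^bsub>F\<^esub> ?w m) i"
        using vm Suc.prems by (auto simp: free_module_apply less_Suc_eq)
    qed (use w e vm Suc.prems in \<open>auto intro: R.free_module_closed\<close>)
    hence "h (?w (Suc m)) = v m \<odot>\<^bsub>M\<^esub> basis_image m \<oplus>\<^bsub>M\<^esub> h (?w m)"
      using e w vm Suc.prems by (simp only: h_add h_smult F.smult_closed basis_image_def Suc_le_lessD)
    thus ?case using step[OF _ Suc.IH] Suc.prems by (simp del: restrict_apply)
  qed
  hence "h (?w n) \<in> N n" by simp
  moreover have "?w n = v"
    by (rule free_module_ext[of _ R n]) (use v w[of n] in auto)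
  ultimately show ?thesis by simp
qed

lemma carrier_subset_partial_span:
  "carrier M \<subseteq> partial_span R M structure_map basis_image n"
proof
  fix x assume "x \<in> carrier M"
  then obtain v where v: "v \<in> carrier F" "x = h v" using surj by blast
  have "h v \<in> partial_span R M structure_map basis_image n"
  proof (rule h_induct[OF v(1), where N = "partial_span R M structure_map basis_image"])
    fix m x assume "m < n" "x \<in> partial_span R M structure_map basis_image m"
    thus "v m \<odot>\<^bsub>M\<^esub> basis_image m \<oplus>\<^bsub>M\<^esub> x \<in> partial_span R M structure_map basis_image (Suc m)"
      using free_module_mem[OF v(1)] by (force simp: smult_eq_structure_map)
  qed simp
  thus "x \<in> partial_span R M structure_map basis_image n" using v by simp
qed

text \<open>By minimality of \<open>submodule_span\<close>, it suffices that \<open>span_mod\<close>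
  gives a submodule containing \<open>X\<close>. It is cut down to the carrier because its vectors
  are arbitrary from index \<open>n\<close> on.\<close>

lemma kernel_subset_span_mod:
  assumes K: "a_kernel F M h = submodule_span R F X" "X \<subseteq> carrier F" and XG: "X \<subseteq> G"
    and G: "G \<subseteq> {..<n} \<rightarrow> carrier R" and P: "ideal P R"
    and v: "v \<in> carrier F" "h v = \<zero>\<^bsub>M\<^esub>"
  shows "v \<in> span_mod R {..<n} G P"
proof -
  interpret P: ideal P R by fact
  interpret F: Module.module R F by (rule R.free_module_module)
  let ?N = "carrier F \<inter> span_mod R {..<n} G P"
  have smult: "r \<odot>\<^bsub>F\<^esub> x \<in> ?N" if "r \<in> carrier R" "x \<in> ?N" for r x
    using that by (auto intro: span_mod.smult simp: R.free_module_closed free_module_apply)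
  have "submodule ?N R F"
  proof (rule F.submoduleI)
    show "\<zero>\<^bsub>F\<^esub> \<in> ?N"
      by (auto intro: span_mod.zero_mod simp: R.free_module_closed free_module_apply)
    show "a \<oplus>\<^bsub>F\<^esub> b \<in> ?N" if "a \<in> ?N" "b \<in> ?N" for a b
      using that by (auto intro: span_mod.add simp: R.free_module_closed free_module_apply)
    show "\<ominus>\<^bsub>F\<^esub> a \<in> ?N" if "a \<in> ?N" for a
    proof -
      have "\<ominus>\<^bsub>F\<^esub> a = (\<ominus> \<one>) \<odot>\<^bsub>F\<^esub> a" using that by (simp add: F.smult_l_minus)
      thus ?thesis using smult[of "\<ominus> \<one>" a] that by simp
    qed
  qed (use smult in auto)
  moreover have "X \<subseteq> ?N" using K(2) XG by (auto intro: R.span_mod_generator)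
  ultimately have "submodule_span R F X \<subseteq> ?N" unfolding submodule_span_def by blast
  moreover have "v \<in> a_kernel F M h" using v by (simp add: a_kernel_def')
  ultimately show ?thesis using K(1) by blast
qed

end

section \<open>Presentation of the quotient by the ideal generated by \<open>Y\<close>, and going
  down\<close>

locale presented_quotient = generated_algebra +
  fixes X :: "(nat \<Rightarrow> 'a) set" and Y :: "'c set" and u :: "'c \<Rightarrow> nat \<Rightarrow> nat \<Rightarrow> 'a"
  assumes X: "X \<subseteq> carrier F" and kernel: "a_kernel F M h = submodule_span R F X"
    and Y: "Y \<subseteq> carrier M"
    and u_closed: "y \<in> Y \<Longrightarrow> i < n \<Longrightarrow> u y i \<in> carrier F"
    and h_u: "y \<in> Y \<Longrightarrow> i < n \<Longrightarrow> h (u y i) = y \<otimes>\<^bsub>M\<^esub> basis_image i"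
begin

text \<open>The elements \<open>basis_image i\<close> generate \<open>M\<close> as a module, so
  their products with the members of \<open>Y\<close> generate the ideal of \<open>Y\<close> as a
  module. The vectors \<open>u y i\<close> lift these products; together with \<open>X\<close> they
  present \<open>M / (Y)\<close>.\<close>

definition relations :: "(nat \<Rightarrow> 'a) set" where
  "relations = X \<union> (\<Union>y\<in>Y. u y ` {..<n})"

text \<open>The ideal of \<open>M\<close> generated by \<open>Y\<close> and the image of \<open>P\<close>.\<close>

definition image_ideal :: "'a set \<Rightarrow> 'c set" where
  "image_ideal P = h ` (carrier F \<inter> span_mod R {..<n} relations P)"

lemma relations_in_F: "relations \<subseteq> carrier F"
  using X u_closed by (auto simp: relations_def)

lemma relations_closed: "relations \<subseteq> {..<n} \<rightarrow> carrier R"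
proof
  fix l assume "l \<in> relations"
  hence "l \<in> carrier F" using relations_in_F by blast
  thus "l \<in> {..<n} \<rightarrow> carrier R" using free_module_mem[of l R n] by auto
qed

lemma h_relation_X: "x \<in> X \<Longrightarrow> h x = \<zero>\<^bsub>M\<^esub>"
proof -
  assume "x \<in> X"
  hence "x \<in> submodule_span R F X" by (auto simp: submodule_span_def)
  thus ?thesis unfolding kernel[symmetric] by (simp add: a_kernel_def')
qed

lemma span_mod_in_carrier:
  "ideal P R \<Longrightarrow> v \<in> span_mod R {..<n} relations P \<Longrightarrow> i < n \<Longrightarrow> v i \<in> carrier R"
  using R.span_mod_closed[OF relations_closed, of P v] additive_subgroup.a_subset ideal.axioms(1)
  by blast

lemma restrict_span_mod_in_F:
  "ideal P R \<Longrightarrow> v \<in> span_mod R {..<n} relations P \<Longrightarrow> restrict v {..<n} \<in> carrier F"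
  by (intro restrict_in_free_module) (auto intro: span_mod_in_carrier)

lemma restrict_F: "v \<in> carrier F \<Longrightarrow> restrict v {..<n} = v"
  by (auto simp: free_module_def)

lemma h_restrict_add:
  assumes "ideal P R" "x \<in> span_mod R {..<n} relations P" "y \<in> span_mod R {..<n} relations P"
    and "\<forall>i\<in>{..<n}. v i = x i \<oplus> y i"
  shows "h (restrict v {..<n}) = h (restrict x {..<n}) \<oplus>\<^bsub>M\<^esub> h (restrict y {..<n})"
proof -
  have "restrict v {..<n} = restrict x {..<n} \<oplus>\<^bsub>F\<^esub> restrict y {..<n}"
    using assms(4) by (auto simp: free_module_def)
  thus ?thesis using assms by (simp add: h_add restrict_span_mod_in_F)
qed

lemma h_restrict_smult:
  assumes "ideal P R" "r \<in> carrier R" "x \<in> span_mod R {..<n} relations P"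
    and "\<forall>i\<in>{..<n}. v i = r \<otimes> x i"
  shows "h (restrict v {..<n}) = r \<odot>\<^bsub>M\<^esub> h (restrict x {..<n})"
proof -
  have "restrict v {..<n} = r \<odot>\<^bsub>F\<^esub> restrict x {..<n}"
    using assms(4) by (auto simp: free_module_def)
  thus ?thesis using assms by (simp add: h_smult restrict_span_mod_in_F)
qed

lemma image_idealI:
  "v \<in> carrier F \<Longrightarrow> v \<in> span_mod R {..<n} relations P \<Longrightarrow> h v \<in> image_ideal P"
  by (auto simp: image_ideal_def)

lemma image_ideal_zero: "ideal P R \<Longrightarrow> \<zero>\<^bsub>M\<^esub> \<in> image_ideal P"
proof -
  interpret F: Module.module R F by (rule R.free_module_module)
  assume "ideal P R"
  then interpret P: ideal P R .
  have "h (\<zero> \<odot>\<^bsub>F\<^esub> \<zero>\<^bsub>F\<^esub>) = \<zero> \<odot>\<^bsub>M\<^esub> h \<zero>\<^bsub>F\<^esub>" by (simp only: h_smult R.zero_closed F.zero_closed)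
  hence "h \<zero>\<^bsub>F\<^esub> = \<zero>\<^bsub>M\<^esub>" by simp
  moreover have "h \<zero>\<^bsub>F\<^esub> \<in> image_ideal P"
    by (intro image_idealI span_mod.zero_mod) (auto simp: free_module_apply)
  ultimately show ?thesis by simp
qed

lemma image_ideal_add:
  assumes "ideal P R" "s \<in> image_ideal P" "t \<in> image_ideal P"
  shows "s \<oplus>\<^bsub>M\<^esub> t \<in> image_ideal P"
proof -
  obtain v w where vw: "v \<in> carrier F" "v \<in> span_mod R {..<n} relations P" "s = h v"
    "w \<in> carrier F" "w \<in> span_mod R {..<n} relations P" "t = h w"
    using assms(2,3) by (auto simp: image_ideal_def)
  have "h (v \<oplus>\<^bsub>F\<^esub> w) \<in> image_ideal P"
    using vw by (intro image_idealI R.free_module_closed span_mod.add[OF vw(2,5)])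
      (auto simp: free_module_apply)
  thus ?thesis using vw by (simp add: h_add)
qed

lemma image_ideal_smult:
  assumes "ideal P R" "r \<in> carrier R" "t \<in> image_ideal P"
  shows "r \<odot>\<^bsub>M\<^esub> t \<in> image_ideal P"
proof -
  obtain v where v: "v \<in> carrier F" "v \<in> span_mod R {..<n} relations P" "t = h v"
    using assms(3) by (auto simp: image_ideal_def)
  have "h (r \<odot>\<^bsub>F\<^esub> v) \<in> image_ideal P"
    using v assms(2) by (intro image_idealI R.free_module_closed span_mod.smult[OF assms(2) v(2)])
      (auto simp: free_module_apply)
  thus ?thesis using v assms(2) by (simp add: h_smult)
qed

lemma image_ideal_carrier: "image_ideal P \<subseteq> carrier M"
  by (auto simp: image_ideal_def)

lemma smult_h_in_image_ideal:
  assumes "ideal P R" "p \<in> P" "w \<in> carrier F"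
  shows "p \<odot>\<^bsub>M\<^esub> h w \<in> image_ideal P"
proof -
  interpret P: ideal P R by fact
  have p: "p \<in> carrier R" using assms(2) by (rule P.Icarr)
  have "h (p \<odot>\<^bsub>F\<^esub> w) \<in> image_ideal P"
    using p assms(2,3) P.I_r_closed free_module_mem[OF assms(3)]
    by (intro image_idealI R.free_module_closed span_mod.zero_mod) (auto simp: free_module_apply)
  thus ?thesis using p assms(3) by (simp add: h_smult)
qed

text \<open>Multiplication by \<open>s\<close> is linear over \<open>R\<close>, so generators
  suffice. The coefficient \<open>v m\<close> stays in the hypothesis because membership comes
  either from a coefficient in \<open>P\<close> or from a factor in \<open>Y\<close>.\<close>

lemma mult_h_in_image_ideal:
  assumes P: "ideal P R" and v: "v \<in> carrier F" and s: "s \<in> carrier M"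
    and gen: "\<And>m. m < n \<Longrightarrow> v m \<odot>\<^bsub>M\<^esub> (s \<otimes>\<^bsub>M\<^esub> basis_image m) \<in> image_ideal P"
  shows "s \<otimes>\<^bsub>M\<^esub> h v \<in> image_ideal P"
proof -
  have "h v \<in> {x \<in> carrier M. s \<otimes>\<^bsub>M\<^esub> x \<in> image_ideal P}"
  proof (rule h_induct[OF v, where N = "\<lambda>_. {x \<in> carrier M. s \<otimes>\<^bsub>M\<^esub> x \<in> image_ideal P}"])
    show "\<zero>\<^bsub>M\<^esub> \<in> {x \<in> carrier M. s \<otimes>\<^bsub>M\<^esub> x \<in> image_ideal P}"
      using s image_ideal_zero[OF P] by simp
  next
    fix m x assume m: "m < n" and x: "x \<in> {x \<in> carrier M. s \<otimes>\<^bsub>M\<^esub> x \<in> image_ideal P}"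
    have vm: "v m \<in> carrier R" using v m by (rule free_module_mem)
    have "s \<otimes>\<^bsub>M\<^esub> (v m \<odot>\<^bsub>M\<^esub> basis_image m) = v m \<odot>\<^bsub>M\<^esub> (s \<otimes>\<^bsub>M\<^esub> basis_image m)"
      using s vm smult_assoc2[OF vm _ s, of "basis_image m"]
      by (simp add: m_comm[of s])
    hence "s \<otimes>\<^bsub>M\<^esub> (v m \<odot>\<^bsub>M\<^esub> basis_image m \<oplus>\<^bsub>M\<^esub> x) =
        v m \<odot>\<^bsub>M\<^esub> (s \<otimes>\<^bsub>M\<^esub> basis_image m) \<oplus>\<^bsub>M\<^esub> s \<otimes>\<^bsub>M\<^esub> x"
      using s vm x by (simp add: r_distr)
    also have "\<dots> \<in> image_ideal P" using gen[OF m] x by (intro image_ideal_add[OF P]) auto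
    finally show "v m \<odot>\<^bsub>M\<^esub> basis_image m \<oplus>\<^bsub>M\<^esub> x \<in> {x \<in> carrier M. s \<otimes>\<^bsub>M\<^esub> x \<in> image_ideal P}"
      using vm x by simp
  qed
  thus ?thesis by simp
qed

lemma mult_Y_in_image_ideal:
  assumes P: "ideal P R" and y: "y \<in> Y" and t: "t \<in> carrier M"
  shows "y \<otimes>\<^bsub>M\<^esub> t \<in> image_ideal P"
proof -
  obtain w where w: "w \<in> carrier F" "t = h w" using t surj by blast
  have "y \<otimes>\<^bsub>M\<^esub> basis_image m \<in> image_ideal P" if "m < n" for m
    unfolding h_u[OF y that, symmetric]
    using y that by (intro image_idealI u_closed R.span_mod_generator) (auto simp: relations_def)
  thus ?thesis unfolding w(2)
    using y Y free_module_mem[OF w(1)]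
    by (intro mult_h_in_image_ideal[OF P w(1)] image_ideal_smult[OF P]) auto
qed

text \<open>The members of \<open>X\<close> map to zero, vectors with entries in \<open>P\<close>
  keep their coefficients in \<open>P\<close>, and for a lift of
  \<open>y \<otimes> basis_image i\<close> the factor \<open>s\<close> is moved past
  \<open>y\<close>, leaving a multiple of \<open>y\<close>.\<close>

lemma mult_in_image_ideal:
  assumes P: "ideal P R" and s: "s \<in> carrier M" and t: "t \<in> image_ideal P"
  shows "s \<otimes>\<^bsub>M\<^esub> t \<in> image_ideal P"
proof -
  interpret P: ideal P R by fact
  have *: "s \<otimes>\<^bsub>M\<^esub> h (restrict v {..<n}) \<in> image_ideal P"
    if "v \<in> span_mod R {..<n} relations P" for v
    using that
  proof induction
    case (zero_mod v)
    have v: "restrict v {..<n} \<in> carrier F"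
      by (rule restrict_in_free_module) (use zero_mod P.Icarr in auto)
    show ?case
    proof (rule mult_h_in_image_ideal[OF P v s])
      fix m assume m: "m < n"
      have "s \<otimes>\<^bsub>M\<^esub> basis_image m \<in> h ` carrier F" using surj s by simp
      then obtain w where "s \<otimes>\<^bsub>M\<^esub> basis_image m = h w" "w \<in> carrier F" by (rule imageE)
      thus "restrict v {..<n} m \<odot>\<^bsub>M\<^esub> (s \<otimes>\<^bsub>M\<^esub> basis_image m) \<in> image_ideal P"
        using smult_h_in_image_ideal[OF P, of "v m" w] m zero_mod by simp
    qed
  next
    case (gen l v)
    hence "restrict v {..<n} = restrict l {..<n}" by auto
    moreover have "l \<in> carrier F" using gen relations_in_F by blast
    ultimately have v: "restrict v {..<n} = l" by (simp add: restrict_F)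
    from gen(1) consider "l \<in> X" | y i where "y \<in> Y" "i < n" "l = u y i"
      by (auto simp: relations_def)
    thus ?case
    proof cases
      case 1
      thus ?thesis unfolding v using s image_ideal_zero[OF P] by (simp add: h_relation_X)
    next
      case 2
      have "y \<in> carrier M" using 2 Y by blast
      hence "s \<otimes>\<^bsub>M\<^esub> h l = y \<otimes>\<^bsub>M\<^esub> (s \<otimes>\<^bsub>M\<^esub> basis_image i)"
        using s 2 by (simp add: h_u m_lcomm)
      thus ?thesis unfolding v using mult_Y_in_image_ideal[OF P 2(1)] s by simp
    qed
  next
    case (add x y v)
    thus ?case using s h_restrict_add[OF P add.hyps] restrict_span_mod_in_F[OF P add.hyps(1)]
        restrict_span_mod_in_F[OF P add.hyps(2)]
      by (simp add: r_distr image_ideal_add[OF P] del: restrict_apply)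
  next
    case (smult r x v)
    have x: "h (restrict x {..<n}) \<in> carrier M"
      using restrict_span_mod_in_F[OF P smult.hyps(2)] by simp
    have "s \<otimes>\<^bsub>M\<^esub> (r \<odot>\<^bsub>M\<^esub> h (restrict x {..<n})) = r \<odot>\<^bsub>M\<^esub> (s \<otimes>\<^bsub>M\<^esub> h (restrict x {..<n}))"
      using s x smult.hyps(1) smult_assoc2[OF smult.hyps(1) x s]
      by (simp add: m_comm[of s] del: restrict_apply)
    thus ?case
      using h_restrict_smult[OF P smult.hyps] image_ideal_smult[OF P smult.hyps(1) smult.IH]
      by (simp del: restrict_apply)
  qed
  obtain v where v: "v \<in> carrier F" "v \<in> span_mod R {..<n} relations P" "t = h v"
    using t by (auto simp: image_ideal_def)
  show ?thesis using *[OF v(2)] unfolding restrict_F[OF v(1)] v(3) .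
qed

lemma ideal_image_ideal:
  assumes P: "ideal P R"
  shows "ideal (image_ideal P) M"
proof -
  note carr = subsetD[OF image_ideal_carrier]
  show ?thesis
  proof (rule idealI[OF ring_axioms])
    show "subgroup (image_ideal P) (add_monoid M)"
    proof (rule M.add.subgroupI)
      show "\<ominus>\<^bsub>M\<^esub> a \<in> image_ideal P" if "a \<in> image_ideal P" for a
      proof -
        have "\<ominus>\<^bsub>M\<^esub> a = (\<ominus> \<one>) \<odot>\<^bsub>M\<^esub> a"
          using carr[OF that] by (simp add: smult_l_minus)
        thus ?thesis using image_ideal_smult[OF P _ that] by simp
      qed
      show "image_ideal P \<subseteq> carrier M" by (rule image_ideal_carrier)
      show "image_ideal P \<noteq> {}" using image_ideal_zero[OF P] by blast
      show "a \<oplus>\<^bsub>M\<^esub> b \<in> image_ideal P" if "a \<in> image_ideal P" "b \<in> image_ideal P" for a b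
        using that by (rule image_ideal_add[OF P])
    qed
    fix a x assume ax: "a \<in> image_ideal P" "x \<in> carrier M"
    show "x \<otimes>\<^bsub>M\<^esub> a \<in> image_ideal P" using mult_in_image_ideal[OF P ax(2,1)] .
    thus "a \<otimes>\<^bsub>M\<^esub> x \<in> image_ideal P" using ax carr by (simp add: m_comm)
  qed
qed

lemma Y_subset_image_ideal:
  assumes "ideal P R"
  shows "Y \<subseteq> image_ideal P"
proof
  fix y assume "y \<in> Y"
  thus "y \<in> image_ideal P" using mult_Y_in_image_ideal[OF assms, of y "\<one>\<^bsub>M\<^esub>"] Y by auto
qed

lemma image_ideal_minimal:
  assumes P: "ideal P R" and Q: "ideal Q M" "Y \<subseteq> Q" "P \<subseteq> contraction R structure_map Q"
  shows "image_ideal P \<subseteq> Q"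
proof -
  interpret P: ideal P R by fact
  interpret Q: ideal Q M by fact
  interpret f: ring_hom_cring R M structure_map by (rule structure_map_hom)
  have *: "h (restrict v {..<n}) \<in> Q" if "v \<in> span_mod R {..<n} relations P" for v
    using that
  proof induction
    case (zero_mod v)
    have v: "restrict v {..<n} \<in> carrier F"
      by (rule restrict_in_free_module) (use zero_mod P.Icarr in auto)
    show ?case
    proof (rule h_induct[OF v, where N = "\<lambda>_. Q"])
      fix m x assume m: "m < n" and x: "x \<in> Q"
      have "v m \<in> carrier R" "structure_map (v m) \<in> Q"
        using m zero_mod Q(3) by (auto simp: contraction_def)
      hence "v m \<odot>\<^bsub>M\<^esub> basis_image m \<in> Q" by (simp add: smult_eq_structure_map Q.I_r_closed)
      thus "restrict v {..<n} m \<odot>\<^bsub>M\<^esub> basis_image m \<oplus>\<^bsub>M\<^esub> x \<in> Q" using m x by (simp add: Q.a_closed)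
    qed (rule Q.zero_closed)
  next
    case (gen l v)
    hence "restrict v {..<n} = restrict l {..<n}" by auto
    moreover have "l \<in> carrier F" using gen relations_in_F by blast
    ultimately have v: "restrict v {..<n} = l" by (simp add: restrict_F)
    from gen(1) consider "l \<in> X" | y i where "y \<in> Y" "i < n" "l = u y i"
      by (auto simp: relations_def)
    thus ?case
    proof cases
      case 1
      thus ?thesis unfolding v using Q.zero_closed by (simp add: h_relation_X)
    next
      case 2
      have "y \<in> Q" using 2(1) Q(2) by blast
      thus ?thesis unfolding v using 2 by (simp add: h_u Q.I_r_closed)
    qed
  next
    case (add x y v)
    thus ?case using h_restrict_add[OF P add.hyps] Q.a_closed by (simp del: restrict_apply)
  next
    case (smult r x v)
    thus ?case using h_restrict_smult[OF P smult.hyps] restrict_span_mod_in_F[OF P smult.hyps(2)]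
      by (simp add: smult_eq_structure_map Q.I_l_closed del: restrict_apply)
  qed
  show ?thesis
  proof
    fix t assume "t \<in> image_ideal P"
    then obtain v where v: "v \<in> carrier F" "v \<in> span_mod R {..<n} relations P" "t = h v"
      by (auto simp: image_ideal_def)
    show "t \<in> Q" using *[OF v(2)] unfolding restrict_F[OF v(1)] v(3) .
  qed
qed

text \<open>Two preimages of one element differ by a kernel vector, which the relations in
  \<open>X\<close> already generate. The span is thus the full preimage of the ideal, so
  torsion-freeness of vectors carries over to \<open>M\<close>.\<close>

lemma in_image_idealD:
  assumes P: "ideal P R" and v: "v \<in> carrier F" "h v \<in> image_ideal P"
  shows "v \<in> span_mod R {..<n} relations P"
proof -
  interpret F: Module.module R F by (rule R.free_module_module)
  obtain w where w: "w \<in> carrier F" "w \<in> span_mod R {..<n} relations P" "h v = h w"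
    using v(2) by (auto simp: image_ideal_def)
  let ?d = "v \<oplus>\<^bsub>F\<^esub> (\<ominus> \<one>) \<odot>\<^bsub>F\<^esub> w"
  have d: "?d \<in> carrier F" using v(1) w(1) by (simp add: R.free_module_closed)
  have "h ?d = \<zero>\<^bsub>M\<^esub>"
    using v(1) w(1,3) by (simp add: h_add h_smult smult_l_minus M.r_neg R.free_module_closed)
  hence "?d \<in> span_mod R {..<n} relations P"
    using d by (intro kernel_subset_span_mod[OF kernel X _ relations_closed P])
      (auto simp: relations_def)
  thus ?thesis
  proof (rule span_mod.add[OF w(2)])
    have "v i = w i \<oplus> (v i \<oplus> (\<ominus> \<one>) \<otimes> w i)" if "i < n" for i
      using free_module_mem[OF v(1) that] free_module_mem[OF w(1) that] by algebra
    thus "\<forall>i\<in>{..<n}. v i = w i \<oplus> ?d i" by (simp add: free_module_apply)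
  qed
qed

lemma torsion_free_image_ideal:
  assumes P': "ideal P' R" and tf: "torsion_free_at R {..<n} relations P P'"
    and b: "b \<in> carrier R - P'" and t: "t \<in> carrier M" "b \<odot>\<^bsub>M\<^esub> t \<in> image_ideal P'"
  shows "\<exists>s\<in>carrier R - P. s \<odot>\<^bsub>M\<^esub> t \<in> image_ideal P'"
proof -
  obtain v where v: "v \<in> carrier F" "t = h v" using t(1) surj by blast
  have vc: "v \<in> {..<n} \<rightarrow> carrier R" using free_module_mem[OF v(1)] by auto
  \<comment> \<open>Vectors of \<open>F\<close> are \<open>undefined\<close> from index
    \<open>n\<close> on, unlike the abstractions in \<open>torsion_free_at\<close>; only the
    coordinates below \<open>n\<close> count.\<close>
  have cong: "y \<in> span_mod R {..<n} relations P'"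
    if "x \<in> span_mod R {..<n} relations P'" "\<And>i. i < n \<Longrightarrow> y i = x i" for x y
    by (rule span_mod.smult[OF R.one_closed that(1)])
      (use that(2) span_mod_in_carrier[OF P' that(1)] in auto)
  have "h (b \<odot>\<^bsub>F\<^esub> v) \<in> image_ideal P'" using t(2) b v by (simp add: h_smult)
  hence "b \<odot>\<^bsub>F\<^esub> v \<in> span_mod R {..<n} relations P'"
    using b v by (intro in_image_idealD[OF P']) (auto simp: R.free_module_closed)
  hence "(\<lambda>i. b \<otimes> v i) \<in> span_mod R {..<n} relations P'"
    by (rule cong) (simp add: free_module_apply)
  then obtain s where s: "s \<in> carrier R - P" "(\<lambda>i. s \<otimes> v i) \<in> span_mod R {..<n} relations P'"
    using tf vc b unfolding torsion_free_at_def by blast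
  have "s \<odot>\<^bsub>F\<^esub> v \<in> span_mod R {..<n} relations P'"
    by (rule cong[OF s(2)]) (simp add: free_module_apply)
  hence "h (s \<odot>\<^bsub>F\<^esub> v) \<in> image_ideal P'"
    using s(1) v by (intro image_idealI) (auto simp: R.free_module_closed)
  thus ?thesis using s(1) v by (intro bexI[of _ s]) (auto simp: h_smult)
qed

text \<open>Going down: torsion-freeness produces a prime over \<open>P'\<close> that contains \<open>Y\<close> and is contained
  in \<open>Q\<close>.\<close>

lemma contraction_minimal:
  assumes Q: "Q \<in> minimal_primes M Y" and P': "primeideal P' R"
    and sub: "P' \<subseteq> contraction R structure_map Q"
    and tf: "torsion_free_at R {..<n} relations (contraction R structure_map Q) P'"
  shows "P' = contraction R structure_map Q"
proof -
  interpret f: ring_hom_cring R M structure_map by (rule structure_map_hom)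
  interpret P': primeideal P' R by fact
  have Qp: "primeideal Q M" "Y \<subseteq> Q" using Q by (auto simp: minimal_primes_def)
  interpret Q: primeideal Q M by fact
  let ?E = "image_ideal P'"
  have EQ: "?E \<subseteq> Q" by (rule image_ideal_minimal[OF P'.is_ideal Q.is_ideal Qp(2) sub])
  \<comment> \<open>For a prime avoiding these products, the case of \<open>t\<close> equal to one
    bounds its contraction by \<open>P'\<close>, and the case of \<open>b\<close> equal to one keeps
    it inside \<open>Q\<close>.\<close>
  let ?W = "{structure_map b \<otimes>\<^bsub>M\<^esub> t | b t. b \<in> carrier R - P' \<and> t \<in> carrier M - Q}"
  have disjoint: "?E \<inter> ?W = {}"
  proof (rule ccontr)
    assume "?E \<inter> ?W \<noteq> {}"
    then obtain b t where bt: "b \<in> carrier R - P'" "t \<in> carrier M - Q" "structure_map b \<otimes>\<^bsub>M\<^esub> t \<in> ?E"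
      by auto
    hence "b \<odot>\<^bsub>M\<^esub> t \<in> ?E" by (simp add: smult_eq_structure_map)
    \<comment> \<open>Torsion-freeness trades \<open>b\<close>, whose image may lie in
      \<open>Q\<close>, for an \<open>s\<close> whose image does not; the product with
      \<open>t\<close> then contradicts primality of \<open>Q\<close>.\<close>
    then obtain s where s: "s \<in> carrier R - contraction R structure_map Q" "s \<odot>\<^bsub>M\<^esub> t \<in> ?E"
      using torsion_free_image_ideal[OF P'.is_ideal tf bt(1)] bt(2) by auto
    hence "structure_map s \<otimes>\<^bsub>M\<^esub> t \<in> Q" using EQ bt(2) by (auto simp: smult_eq_structure_map)
    thus False using Q.I_prime[of "structure_map s" t] s(1) bt(2) by (auto simp: contraction_def)
  qed
  have W: "?W \<subseteq> carrier M" by auto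
  have one: "\<one> \<in> carrier R - P'" "\<one>\<^bsub>M\<^esub> \<in> carrier M - Q"
    using primeideal_one[OF P'] primeideal_one[OF Qp(1)] by auto
  hence one_W: "\<one>\<^bsub>M\<^esub> \<in> ?W" by (intro CollectI exI[of _ \<one>] exI[of _ "\<one>\<^bsub>M\<^esub>"]) auto
  have mult_W: "x \<otimes>\<^bsub>M\<^esub> y \<in> ?W" if xy: "x \<in> ?W" "y \<in> ?W" for x y
  proof -
    obtain b t c s where *: "b \<in> carrier R - P'" "t \<in> carrier M - Q" "x = structure_map b \<otimes>\<^bsub>M\<^esub> t"
      "c \<in> carrier R - P'" "s \<in> carrier M - Q" "y = structure_map c \<otimes>\<^bsub>M\<^esub> s"
      using xy by auto
    have "x \<otimes>\<^bsub>M\<^esub> y = structure_map (b \<otimes> c) \<otimes>\<^bsub>M\<^esub> (t \<otimes>\<^bsub>M\<^esub> s)"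
      using * by (simp add: m_ac)
    moreover have "b \<otimes> c \<in> carrier R - P'" "t \<otimes>\<^bsub>M\<^esub> s \<in> carrier M - Q"
      using * P'.I_prime Q.I_prime by auto
    ultimately show ?thesis by blast
  qed
  obtain Q' where Q': "primeideal Q' M" "?E \<subseteq> Q'" "Q' \<inter> ?W = {}"
    using exists_prime_disjoint[OF ideal_image_ideal[OF P'.is_ideal] W one_W mult_W disjoint]
    by blast
  have "t \<in> ?W" if "t \<in> carrier M - Q" for t
    using that one by (intro CollectI exI[of _ \<one>] exI[of _ t]) auto
  hence "Q' \<subseteq> Q" using Q'(3) primeideal_carrier[OF Q'(1)] by blast
  moreover have "Y \<subseteq> Q'" using Y_subset_image_ideal[OF P'.is_ideal] Q'(2) by blast
  ultimately have "Q' = Q" using Q Q'(1) by (simp add: minimal_primes_def)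
  have "structure_map b \<in> ?W" if "b \<in> carrier R - P'" for b
    using that one by (intro CollectI exI[of _ b] exI[of _ "\<one>\<^bsub>M\<^esub>"]) auto
  hence "contraction R structure_map Q \<subseteq> P'" using Q'(3) \<open>Q' = Q\<close> by (auto simp: contraction_def)
  with sub show ?thesis by blast
qed

lemma finite_minimal_primes:
  assumes R: "fgfc_ring R" and fin: "finite X" "finite Y"
  shows "finite (minimal_primes M Y)"
proof -
  interpret f: ring_hom_cring R M structure_map by (rule structure_map_hom)
  have "finite relations" using fin by (simp add: relations_def)
  then obtain \<X> where \<X>: "finite \<X>" "\<forall>X\<in>\<X>. finite X \<and> X \<subseteq> carrier R"
    "\<And>P. primeideal P R \<Longrightarrow> \<exists>X\<in>\<X>. X \<subseteq> P \<and> (\<forall>P'. primeideal P' R \<longrightarrow> X \<subseteq> P' \<longrightarrow> P' \<subseteq> P \<longrightarrow>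
      torsion_free_at R {..<n} relations P P')"
    using R.finite_stratification[OF finite_lessThan _ relations_closed] by blast
  let ?c = "contraction R structure_map"
  let ?\<P> = "\<Union>X\<in>\<X>. minimal_primes R X"
  have "finite ?\<P>" using \<X>(1,2) R by (simp add: R.fgfc_ring_iff)
  moreover have "?c Q \<in> ?\<P>" if Q: "Q \<in> minimal_primes M Y" for Q
  proof -
    have P: "primeideal (?c Q) R"
      using Q by (intro f.primeideal_contraction) (simp add: minimal_primes_def)
    obtain X where X: "X \<in> \<X>" "X \<subseteq> ?c Q" "\<forall>P'. primeideal P' R \<longrightarrow> X \<subseteq> P' \<longrightarrow> P' \<subseteq> ?c Q \<longrightarrow>
        torsion_free_at R {..<n} relations (?c Q) P'"
      using \<X>(3)[OF P] by blast
    \<comment> \<open>Here \<open>X\<close> is the set attached to \<open>?c Q\<close> by the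
      stratification; going down collapses every prime between the two.\<close>
    have "?c Q \<in> minimal_primes R X"
      unfolding minimal_primes_def using P X contraction_minimal[OF Q] by blast
    thus ?thesis using X(1) by blast
  qed
  hence "minimal_primes M Y = (\<Union>P\<in>?\<P>. {Q \<in> minimal_primes M Y. ?c Q = P})" by blast
  moreover have "finite {Q \<in> minimal_primes M Y. ?c Q = P}" for P
    by (rule f.finite_fibre_of_minimal_primes[OF _ carrier_subset_partial_span]) simp
  ultimately show ?thesis by (metis (no_types, lifting) finite_UN_I)
qed

end

theorem corollary2p5:
  fixes R :: "('a, 'm) ring_scheme" and S :: "('a, 'b, 'n) module_scheme"
  assumes "fgfc_ring R"
    and "algebra R S"
    and "finitely_presented R S"
  shows "fgfc_ring S"
proof -
  interpret algebra R S by fact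
  obtain n h X where h: "h \<in> linear_maps R (free_module R n) S"
      "h ` carrier (free_module R n) = carrier S"
    and X: "finite X" "X \<subseteq> carrier (free_module R n)"
      "a_kernel (free_module R n) S h = submodule_span R (free_module R n) X"
    using assms(3) by (auto simp: finitely_presented_def fg_submodule_def)
  interpret generated_algebra R S n h
    using h by unfold_locales
  have "finite (minimal_primes S Y)" if Y: "finite Y" "Y \<subseteq> carrier S" for Y
  proof -
    \<comment> \<open>Lifts exist because \<open>h\<close> is onto.\<close>
    define u where "u y i = (SOME v. v \<in> carrier F \<and> h v = y \<otimes>\<^bsub>S\<^esub> basis_image i)" for y i
    have u: "u y i \<in> carrier F \<and> h (u y i) = y \<otimes>\<^bsub>S\<^esub> basis_image i" if "y \<in> Y" for y i
    proof -
      have "y \<otimes>\<^bsub>S\<^esub> basis_image i \<in> h ` carrier F" using that Y(2) h(2) by auto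
      hence "\<exists>v. v \<in> carrier F \<and> h v = y \<otimes>\<^bsub>S\<^esub> basis_image i" by auto
      thus ?thesis unfolding u_def by (rule someI_ex)
    qed
    interpret Q: presented_quotient R S n h X Y u
      using X Y u by unfold_locales auto
    show ?thesis by (rule Q.finite_minimal_primes[OF assms(1) X(1) Y(1)])
  qed
  thus ?thesis by (simp add: cring.fgfc_ring_iff[OF M_cring])
qed

end
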